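(* Let $G$ be a finite group. Then $\mathrm{DCom}(G)=\mathrm{Com}(G)$ (the deep commuting graph of $G$ equals the commuting graph of $G$) if and only if the Bogomolov multiplier $B_0(G)$ of $G$ is equal to the Schur multiplier $M(G)$ of $G$, in the sense that $B_0(G)\cong M(G)$ (equivalently, $|B_0(G)|=|M(G)|$).
   Context: Both graphs have vertex set $G$; equality means equality of edge sets. In the commuting graph $\mathrm{Com}(G)$, distinct $x,y\in G$ are joined if $xy=yx$. A central extension of a finite group $G$ is a finite group $H$ together with a surjective homomorphism $\pi\colon H\to G$ whose kernel $Z$ satisfies $Z\leqslant Z(H)$. It is a stem extension if $Z\leqslant Z(H)\cap H'$, where $H'$ is the derived subgroup. A Schur cover of $G$ is a stem extension of $G$ of largest possible order, equivalently a stem extension whose kernel is isomorphic to the Schur multiplier $M(G)$. In the deep commuting graph $\mathrm{DCom}(G)$, distinct $x,y\in G$ are joined if and only if their inverse images in a Schur cover $\pi\colon H\to G$ commute, i.e. $ab=ba$ for some (equivalently, since $\ker\pi$ is central, for all) $a\in\pi^{-1}(x)$, $b\in\pi^{-1}(y)$. This edge set is independent of the choice of Schur cover. Write $[x,y]=x^{-1}y^{-1}xy$ and $x^y=y^{-1}xy$. The nonabelian exterior square $G\wedge G$ is the group generated by symbols $x\wedge y$ ($x,y\in G$) subject to the relations \[(xy)\wedge z=(x^y\wedge z^y)(y\wedge z),\quad x\wedge(yz)=(x\wedge z)(x^z\wedge y^z),\quad x\wedge x=1\] for all $x,y,z\in G$. The map $x\wedge y\mapsto[x,y]$ induces a surjective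 homomorphism $G\wedge G\to G'$ whose kernel is naturally isomorphic to the Schur multiplier $M(G)$ (which is also $(R\cap F')/[R,F]$ when $G\cong F/R$ with $F$ free); identify $M(G)$ with this kernel. Let $M_0(G)=\langle x\wedge y\mid x,y\in G,\ [x,y]=1\rangle\leqslant M(G)$. The Bogomolov multiplier of $G$ is $B_0(G)=M(G)/M_0(G)$. *)

theory Defs
  imports "HOL-Algebra.Generated_Groups"
begin

section \<open>Groups given by generators and relations\<close>

text \<open>A word is a list of letters; \<open>(x, True)\<close> stands for the generator \<open>x\<close> and
  \<open>(x, False)\<close> for its formal inverse.\<close>

type_synonym 'x word = "('x \<times> bool) list"

definition words :: "'x set \<Rightarrow> 'x word set" where
  "words X = lists (X \<times> UNIV)"

text \<open>The least congruence on the words over \<open>X\<close> that contains free cancellation and all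
  pairs \<open>(u, v) \<in> R\<close>, a pair being read as the relation \<open>u = v\<close>.\<close>

inductive_set word_cong :: "'x set \<Rightarrow> ('x word \<times> 'x word) set \<Rightarrow> ('x word \<times> 'x word) set"
  for X :: "'x set" and R :: "('x word \<times> 'x word) set"
where
  word_cong_refl: "u \<in> words X \<Longrightarrow> (u, u) \<in> word_cong X R"
| word_cong_sym: "(u, v) \<in> word_cong X R \<Longrightarrow> (v, u) \<in> word_cong X R"
| word_cong_trans: "(u, v) \<in> word_cong X R \<Longrightarrow> (v, w) \<in> word_cong X R \<Longrightarrow> (u, w) \<in> word_cong X R"
| word_cong_append: "(u, u') \<in> word_cong X R \<Longrightarrow> (v, v') \<in> word_cong X R
    \<Longrightarrow> (u @ v, u' @ v') \<in> word_cong X R"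
| word_cong_cancel: "x \<in> X \<Longrightarrow> ([(x, b), (x, \<not> b)], []) \<in> word_cong X R"
| word_cong_rel: "(u, v) \<in> R \<Longrightarrow> u \<in> words X \<Longrightarrow> v \<in> words X \<Longrightarrow> (u, v) \<in> word_cong X R"

definition word_class :: "'x set \<Rightarrow> ('x word \<times> 'x word) set \<Rightarrow> 'x word \<Rightarrow> 'x word set" where
  "word_class X R w = word_cong X R `` {w}"

definition presented_group :: "'x set \<Rightarrow> ('x word \<times> 'x word) set \<Rightarrow> 'x word set monoid" where
  "presented_group X R =
    \<lparr>carrier = words X // word_cong X R,
     mult = (\<lambda>A B. \<Union>u\<in>A. \<Union>v\<in>B. word_class X R (u @ v)),
     one = word_class X R []\<rparr>"

definition eval_word :: "('a, 'm) monoid_scheme \<Rightarrow> ('x \<Rightarrow> 'a) \<Rightarrow> 'x word \<Rightarrow> 'a" where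
  "eval_word G f w =
    foldr (\<lambda>(x, b) g. (if b then f x else inv\<^bsub>G\<^esub> f x) \<otimes>\<^bsub>G\<^esub> g) w \<one>\<^bsub>G\<^esub>"

text \<open>The map out of a presented group induced by a map \<open>f\<close> on the generators. It is meaningful
  when \<open>f\<close> respects the relations, for then evaluation is constant on each class.\<close>

definition induced_map ::
  "('a, 'm) monoid_scheme \<Rightarrow> ('x \<Rightarrow> 'a) \<Rightarrow> 'x word set \<Rightarrow> 'a" where
  "induced_map G f A = the_elem (eval_word G f ` A)"


section \<open>Exterior square, Schur multiplier and Bogomolov multiplier\<close>

definition commutator :: "('a, 'm) monoid_scheme \<Rightarrow> 'a \<Rightarrow> 'a \<Rightarrow> 'a" where
  "commutator G x y = inv\<^bsub>G\<^esub> x \<otimes>\<^bsub>G\<^esub> inv\<^bsub>G\<^esub> y \<otimes>\<^bsub>G\<^esub> x \<otimes>\<^bsub>G\<^esub> y"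

definition conjugate :: "('a, 'm) monoid_scheme \<Rightarrow> 'a \<Rightarrow> 'a \<Rightarrow> 'a" where
  "conjugate G x y = inv\<^bsub>G\<^esub> y \<otimes>\<^bsub>G\<^esub> x \<otimes>\<^bsub>G\<^esub> y"

definition ext_rels :: "('a, 'm) monoid_scheme \<Rightarrow> (('a \<times> 'a) word \<times> ('a \<times> 'a) word) set" where
  "ext_rels G =
    {([((x \<otimes>\<^bsub>G\<^esub> y, z), True)], [((conjugate G x y, conjugate G z y), True), ((y, z), True)])
      | x y z. x \<in> carrier G \<and> y \<in> carrier G \<and> z \<in> carrier G} \<union>
    {([((x, y \<otimes>\<^bsub>G\<^esub> z), True)], [((x, z), True), ((conjugate G x z, conjugate G y z), True)])
      | x y z. x \<in> carrier G \<and> y \<in> carrier G \<and> z \<in> carrier G} \<union>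
    {([((x, x), True)], []) | x. x \<in> carrier G}"

definition exterior_square :: "('a, 'm) monoid_scheme \<Rightarrow> ('a \<times> 'a) word set monoid" where
  "exterior_square G = presented_group (carrier G \<times> carrier G) (ext_rels G)"

definition wedge :: "('a, 'm) monoid_scheme \<Rightarrow> 'a \<Rightarrow> 'a \<Rightarrow> ('a \<times> 'a) word set" where
  "wedge G x y = word_class (carrier G \<times> carrier G) (ext_rels G) [((x, y), True)]"

text \<open>The homomorphism determined by \<open>wedge G x y \<mapsto> commutator G x y\<close>. Its image is the derived
  subgroup; regarding it as a map into \<open>G\<close> does not change its kernel.\<close>

definition commutator_map :: "('a, 'm) monoid_scheme \<Rightarrow> ('a \<times> 'a) word set \<Rightarrow> 'a" where
  "commutator_map G = induced_map G (\<lambda>(x, y). commutator G x y)"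

definition schur_multiplier :: "('a, 'm) monoid_scheme \<Rightarrow> ('a \<times> 'a) word set monoid" where
  "schur_multiplier G =
    (exterior_square G)\<lparr>carrier := kernel (exterior_square G) G (commutator_map G)\<rparr>"

definition M0 :: "('a, 'm) monoid_scheme \<Rightarrow> ('a \<times> 'a) word set set" where
  "M0 G = generate (exterior_square G)
    {wedge G x y | x y. x \<in> carrier G \<and> y \<in> carrier G \<and> commutator G x y = \<one>\<^bsub>G\<^esub>}"

definition bogomolov_multiplier ::
  "('a, 'm) monoid_scheme \<Rightarrow> ('a \<times> 'a) word set set monoid" where
  "bogomolov_multiplier G = schur_multiplier G Mod M0 G"


section \<open>Schur covers\<close>

definition group_center :: "('a, 'm) monoid_scheme \<Rightarrow> 'a set" where
  "group_center G = {z \<in> carrier G. \<forall>g\<in>carrier G. z \<otimes>\<^bsub>G\<^esub> g = g \<otimes>\<^bsub>G\<^esub> z}"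

definition central_extension ::
  "('a, 'm) monoid_scheme \<Rightarrow> ('h, 'n) monoid_scheme \<Rightarrow> ('h \<Rightarrow> 'a) \<Rightarrow> bool" where
  "central_extension G H \<pi> \<longleftrightarrow>
    group H \<and> finite (carrier H) \<and> \<pi> \<in> hom H G \<and> \<pi> ` carrier H = carrier G \<and>
    kernel H G \<pi> \<subseteq> group_center H"

definition stem_extension ::
  "('a, 'm) monoid_scheme \<Rightarrow> ('h, 'n) monoid_scheme \<Rightarrow> ('h \<Rightarrow> 'a) \<Rightarrow> bool" where
  "stem_extension G H \<pi> \<longleftrightarrow>
    central_extension G H \<pi> \<and> kernel H G \<pi> \<subseteq> group_center H \<inter> derived H (carrier H)"

text \<open>The competitors range over groups on sets of natural numbers only. This is no restriction,
  since every finite group is isomorphic to such a group: see \<open>schur_cover_largest\<close> below.\<close>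

definition schur_cover ::
  "('a, 'm) monoid_scheme \<Rightarrow> ('h, 'n) monoid_scheme \<Rightarrow> ('h \<Rightarrow> 'a) \<Rightarrow> bool" where
  "schur_cover G H \<pi> \<longleftrightarrow> stem_extension G H \<pi> \<and>
    (\<forall>(K :: nat monoid) \<rho>. stem_extension G K \<rho> \<longrightarrow> order K \<le> order H)"


section \<open>Commuting graphs\<close>

text \<open>All graphs have vertex set \<open>carrier G\<close> and are represented by their sets of edges, an edge
  being a two-element set of vertices.\<close>

definition commuting_graph :: "('a, 'm) monoid_scheme \<Rightarrow> 'a set set" where
  "commuting_graph G =
    {{x, y} | x y. x \<in> carrier G \<and> y \<in> carrier G \<and> x \<noteq> y \<and> x \<otimes>\<^bsub>G\<^esub> y = y \<otimes>\<^bsub>G\<^esub> x}"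

definition lifted_commuting_graph ::
  "('a, 'm) monoid_scheme \<Rightarrow> ('h, 'n) monoid_scheme \<Rightarrow> ('h \<Rightarrow> 'a) \<Rightarrow> 'a set set" where
  "lifted_commuting_graph G H \<pi> =
    {{x, y} | x y. x \<in> carrier G \<and> y \<in> carrier G \<and> x \<noteq> y \<and>
      (\<exists>a\<in>carrier H. \<exists>b\<in>carrier H. \<pi> a = x \<and> \<pi> b = y \<and> a \<otimes>\<^bsub>H\<^esub> b = b \<otimes>\<^bsub>H\<^esub> a)}"

text \<open>The edge set does not depend on the Schur cover, so an arbitrary one is chosen.\<close>

definition deep_commuting_graph :: "('a, 'm) monoid_scheme \<Rightarrow> 'a set set" where
  "deep_commuting_graph G =
    (case (SOME (H, \<pi>). schur_cover G (H :: nat monoid) \<pi>) of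
      (H, \<pi>) \<Rightarrow> lifted_commuting_graph G H \<pi>)"


section \<open>Basic facts about the definitions\<close>

lemma word_cong_words: "(u, v) \<in> word_cong X R \<Longrightarrow> u \<in> words X \<and> v \<in> words X"
  by (induction rule: word_cong.induct) (auto simp: words_def)

lemma equiv_word_cong: "equiv (words X) (word_cong X R)"
proof (rule equivI)
  show "word_cong X R \<subseteq> words X \<times> words X"
    using word_cong_words by auto
qed (auto simp: refl_on_def sym_def trans_def intro: word_cong_refl word_cong_sym elim: word_cong_trans)

lemma word_class_eqI: "(u, v) \<in> word_cong X R \<Longrightarrow> word_class X R u = word_class X R v"
  unfolding word_class_def by (rule equiv_class_eq[OF equiv_word_cong])

lemma presented_group_carrier: "carrier (presented_group X R) = word_class X R ` words X"
  by (auto simp: presented_group_def quotient_def word_class_def)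

lemma presented_group_mult:
  assumes "u \<in> words X" "v \<in> words X"
  shows "word_class X R u \<otimes>\<^bsub>presented_group X R\<^esub> word_class X R v = word_class X R (u @ v)"
proof -
  have "word_class X R (u' @ v') = word_class X R (u @ v)"
    if "u' \<in> word_class X R u" "v' \<in> word_class X R v" for u' v'
    using that by (intro word_class_eqI)
      (auto simp: word_class_def intro: word_cong_append word_cong_sym)
  moreover have "u \<in> word_class X R u" "v \<in> word_class X R v"
    using assms by (auto simp: word_class_def intro: word_cong_refl)
  ultimately have "(\<Union>u'\<in>word_class X R u. \<Union>v'\<in>word_class X R v. word_class X R (u' @ v')) =
      word_class X R (u @ v)"
    by blast
  then show ?thesis
    by (simp add: presented_group_def)
qed

lemma words_append [simp]: "u @ v \<in> words X \<longleftrightarrow> u \<in> words X \<and> v \<in> words X"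
  by (auto simp: words_def)

lemma words_Nil [simp]: "[] \<in> words X"
  by (auto simp: words_def)

lemma word_cong_left_inverse:
  assumes "w \<in> words X"
  shows "\<exists>v\<in>words X. (v @ w, []) \<in> word_cong X R"
  using assms
proof (induction w)
  case Nil
  then show ?case
    by (auto intro!: bexI[of _ "[]"] word_cong_refl)
next
  case (Cons p w)
  obtain x b where p: "p = (x, b)"
    by (cases p)
  from Cons.prems have x: "x \<in> X" and w: "w \<in> words X"
    by (auto simp: p words_def)
  from Cons.IH[OF w] obtain v where v: "v \<in> words X" "(v @ w, []) \<in> word_cong X R"
    by blast
  have "([(x, \<not> b), (x, b)], []) \<in> word_cong X R"
    using word_cong_cancel[OF x, of "\<not> b"] by simp
  then have "(v @ [(x, \<not> b), (x, b)] @ w, v @ [] @ w) \<in> word_cong X R"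
    by (intro word_cong_append word_cong_refl v w)
  with v have "((v @ [(x, \<not> b)]) @ p # w, []) \<in> word_cong X R"
    by (auto simp: p intro: word_cong_trans)
  moreover have "v @ [(x, \<not> b)] \<in> words X"
    using v x by (auto simp: words_def)
  ultimately show ?case
    by blast
qed

lemma group_presented_group: "group (presented_group X R)"
proof (rule groupI)
  have one: "\<one>\<^bsub>presented_group X R\<^esub> = word_class X R []"
    by (simp add: presented_group_def)
  show "\<one>\<^bsub>presented_group X R\<^esub> \<in> carrier (presented_group X R)"
    by (auto simp: one presented_group_carrier)
  fix A assume "A \<in> carrier (presented_group X R)"
  then obtain w where w: "w \<in> words X" "A = word_class X R w"
    by (auto simp: presented_group_carrier)
  then show "\<one>\<^bsub>presented_group X R\<^esub> \<otimes>\<^bsub>presented_group X R\<^esub> A = A"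
    by (simp add: one presented_group_mult)
  obtain v where "v \<in> words X" "(v @ w, []) \<in> word_cong X R"
    using word_cong_left_inverse w(1) by blast
  then show "\<exists>B\<in>carrier (presented_group X R).
      B \<otimes>\<^bsub>presented_group X R\<^esub> A = \<one>\<^bsub>presented_group X R\<^esub>"
    using w by (intro bexI[of _ "word_class X R v"])
      (simp_all add: one presented_group_mult presented_group_carrier word_class_eqI)
qed (auto simp: presented_group_carrier presented_group_mult)

lemma (in group) eval_word_closed:
  assumes "w \<in> words X" "\<And>x. x \<in> X \<Longrightarrow> f x \<in> carrier G"
  shows "eval_word G f w \<in> carrier G"
  using assms by (induction w) (auto simp: eval_word_def words_def)

lemma (in group) eval_word_append:
  assumes "u \<in> words X" "v \<in> words X" "\<And>x. x \<in> X \<Longrightarrow> f x \<in> carrier G"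
  shows "eval_word G f (u @ v) = eval_word G f u \<otimes> eval_word G f v"
  using assms(1)
proof (induction u)
  case Nil
  then show ?case
    using eval_word_closed[of v X f] assms(2,3) by (simp add: eval_word_def)
next
  case (Cons p u)
  then show ?case
    using eval_word_closed[of u X f] eval_word_closed[of v X f] assms(2,3)
    by (auto simp: eval_word_def words_def m_assoc)
qed

lemma (in group) eval_word_cong:
  assumes "(u, v) \<in> word_cong X R" "\<And>x. x \<in> X \<Longrightarrow> f x \<in> carrier G"
    and "\<And>u v. (u, v) \<in> R \<Longrightarrow> eval_word G f u = eval_word G f v"
  shows "eval_word G f u = eval_word G f v"
  using assms(1)
proof (induction rule: word_cong.induct)
  case (word_cong_append u u' v v')
  then show ?case
    using word_cong_words[of u u' X R] word_cong_words[of v v' X R] assms(2)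
    by (simp add: eval_word_append[of _ X])
next
  case (word_cong_cancel x b)
  then show ?case
    using assms(2) by (cases b) (auto simp: eval_word_def)
qed (use assms(3) in auto)

lemma (in group) induced_map_class:
  assumes "w \<in> words X" "\<And>x. x \<in> X \<Longrightarrow> f x \<in> carrier G"
    and "\<And>u v. (u, v) \<in> R \<Longrightarrow> eval_word G f u = eval_word G f v"
  shows "induced_map G f (word_class X R w) = eval_word G f w"
proof -
  have eq: "eval_word G f v = eval_word G f w" if "v \<in> word_class X R w" for v
    by (rule eval_word_cong[OF _ assms(2,3), symmetric])
      (use that in \<open>auto simp: word_class_def\<close>)
  have w: "w \<in> word_class X R w"
    using assms(1) by (auto simp: word_class_def intro: word_cong_refl)
  have "eval_word G f ` word_class X R w = (\<lambda>_. eval_word G f w) ` word_class X R w"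
    by (rule image_cong[OF refl eq])
  with w show ?thesis
    by (simp add: induced_map_def image_constant)
qed

lemma (in group) eval_word_ext_rels:
  assumes "(u, v) \<in> ext_rels G"
  shows "eval_word G (\<lambda>(x, y). commutator G x y) u = eval_word G (\<lambda>(x, y). commutator G x y) v"
proof -
  have cancel: "inv a \<otimes> (a \<otimes> b) = b" "a \<otimes> (inv a \<otimes> b) = b"
    if "a \<in> carrier G" "b \<in> carrier G" for a b
    using that by (simp_all flip: m_assoc)
  note simps = eval_word_def commutator_def conjugate_def m_assoc inv_mult_group cancel
  from assms consider
    x y z where "x \<in> carrier G" "y \<in> carrier G" "z \<in> carrier G"
      "u = [((x \<otimes> y, z), True)]" "v = [((conjugate G x y, conjugate G z y), True), ((y, z), True)]"
  | x y z where "x \<in> carrier G" "y \<in> carrier G" "z \<in> carrier G"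
      "u = [((x, y \<otimes> z), True)]" "v = [((x, z), True), ((conjugate G x z, conjugate G y z), True)]"
  | x where "x \<in> carrier G" "u = [((x, x), True)]" "v = []"
    unfolding ext_rels_def Un_iff mem_Collect_eq prod.inject
    by (elim disjE exE conjE) (rule that; assumption)+
  then show ?thesis
    by cases (simp_all add: simps)
qed

lemma (in group) commutator_map_class:
  assumes "w \<in> words (carrier G \<times> carrier G)"
  shows "commutator_map G (word_class (carrier G \<times> carrier G) (ext_rels G) w) =
    eval_word G (\<lambda>(x, y). commutator G x y) w"
proof -
  have "(\<lambda>(x, y). commutator G x y) p \<in> carrier G" if "p \<in> carrier G \<times> carrier G" for p
    using that by (auto simp: commutator_def)
  then show ?thesis
    unfolding commutator_map_def by (rule induced_map_class[OF assms _ eval_word_ext_rels])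
qed

lemma (in group) commutator_map_wedge:
  assumes "x \<in> carrier G" "y \<in> carrier G"
  shows "commutator_map G (wedge G x y) = commutator G x y"
  unfolding wedge_def using assms
  by (subst commutator_map_class) (auto simp: words_def eval_word_def commutator_def)

lemma (in group) commutator_map_hom: "commutator_map G \<in> hom (exterior_square G) G"
proof (rule homI)
  let ?X = "carrier G \<times> carrier G" and ?f = "\<lambda>(x, y). commutator G x y"
  have f: "?f p \<in> carrier G" if "p \<in> ?X" for p
    using that by (auto simp: commutator_def)
  fix A assume "A \<in> carrier (exterior_square G)"
  then obtain u where u: "u \<in> words ?X" "A = word_class ?X (ext_rels G) u"
    by (auto simp: exterior_square_def presented_group_carrier)
  then show "commutator_map G A \<in> carrier G"
    using eval_word_closed[of u ?X ?f] f by (simp add: commutator_map_class)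
  fix B assume "B \<in> carrier (exterior_square G)"
  then obtain v where v: "v \<in> words ?X" "B = word_class ?X (ext_rels G) v"
    by (auto simp: exterior_square_def presented_group_carrier)
  show "commutator_map G (A \<otimes>\<^bsub>exterior_square G\<^esub> B) =
      commutator_map G A \<otimes> commutator_map G B"
    using u v eval_word_append[of u ?X v ?f] f
    by (simp add: exterior_square_def presented_group_mult commutator_map_class)
qed

lemma (in group) group_schur_multiplier: "group (schur_multiplier G)"
proof -
  interpret group_hom "exterior_square G" G "commutator_map G"
    using commutator_map_hom group_axioms group_presented_group
    by (auto simp: group_hom_def group_hom_axioms_def exterior_square_def)
  show ?thesis
    unfolding schur_multiplier_def
    using subgroup_kernel by (rule subgroup.subgroup_is_group) (rule G.group_axioms)
qed

lemma (in group) M0_subset_schur_multiplier: "M0 G \<subseteq> carrier (schur_multiplier G)"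
proof -
  note map_wedge = commutator_map_wedge
  interpret group_hom "exterior_square G" G "commutator_map G"
    using commutator_map_hom group_axioms group_presented_group
    by (auto simp: group_hom_def group_hom_axioms_def exterior_square_def)
  have "wedge G x y \<in> carrier (exterior_square G)" if "x \<in> carrier G" "y \<in> carrier G" for x y
    using that by (auto simp: wedge_def exterior_square_def presented_group_carrier words_def)
  then have "{wedge G x y | x y. x \<in> carrier G \<and> y \<in> carrier G \<and> commutator G x y = \<one>}
      \<subseteq> kernel (exterior_square G) G (commutator_map G)"
    by (auto simp: kernel_def map_wedge)
  then have "M0 G \<subseteq> kernel (exterior_square G) G (commutator_map G)"
    unfolding M0_def by (rule G.generate_subgroup_incl[OF _ subgroup_kernel])
  then show ?thesis
    by (simp add: schur_multiplier_def)
qed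

lemma schur_cover_largest:
  fixes K :: "('k, 'n) monoid_scheme"
  assumes G: "group G" and cover: "schur_cover G H \<pi>" and K: "stem_extension G K \<rho>"
  shows "order K \<le> order H"
proof -
  from K have grp: "group K" and fin: "finite (carrier K)" and hom: "\<rho> \<in> hom K G"
    and surj: "\<rho> ` carrier K = carrier G" and cen: "kernel K G \<rho> \<subseteq> group_center K"
    and der: "kernel K G \<rho> \<subseteq> derived K (carrier K)"
    by (auto simp: stem_extension_def central_extension_def)
  interpret K: group K by (rule grp)
  obtain f :: "'k \<Rightarrow> nat" where f: "inj_on f (carrier K)"
    using finite_imp_inj_to_nat_seg[OF fin] by auto
  define g where "g = inv_into (carrier K) f"
  have gf: "g (f x) = x" if "x \<in> carrier K" for x
    using f that by (simp add: g_def)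
  define N :: "nat monoid" where
    "N = \<lparr>carrier = f ` carrier K, mult = (\<lambda>a b. f (g a \<otimes>\<^bsub>K\<^esub> g b)), one = f \<one>\<^bsub>K\<^esub>\<rparr>"
  have grpN: "group N"
  proof (rule groupI)
    fix a assume "a \<in> carrier N"
    then obtain x where x: "x \<in> carrier K" "a = f x"
      by (auto simp: N_def)
    then show "\<exists>b\<in>carrier N. b \<otimes>\<^bsub>N\<^esub> a = \<one>\<^bsub>N\<^esub>"
      by (intro bexI[of _ "f (inv\<^bsub>K\<^esub> x)"]) (auto simp: N_def gf)
  qed (auto simp: N_def gf K.m_assoc)
  have fhom: "f \<in> hom K N"
    by (auto simp: hom_def N_def gf)
  have f_hom: "group_hom K N f"
    by (rule group_hom.intro[OF grp grpN group_hom_axioms.intro[OF fhom]])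
  have ker: "kernel N G (\<rho> \<circ> g) = f ` kernel K G \<rho>"
    by (auto simp: kernel_def N_def gf)
  have derN: "derived N (carrier N) = f ` derived K (carrier K)"
    using group_hom.derived_img[OF f_hom, of "carrier K"] by (simp add: N_def)
  have "stem_extension G N (\<rho> \<circ> g)"
    unfolding stem_extension_def central_extension_def
  proof (intro conjI)
    show "\<rho> \<circ> g \<in> hom N G"
      using hom by (auto simp: hom_def N_def gf)
    show "(\<rho> \<circ> g) ` carrier N = carrier G"
      using surj by (auto simp: N_def gf image_comp)
    show "kernel N G (\<rho> \<circ> g) \<subseteq> group_center N"
      using cen unfolding ker by (auto simp: group_center_def N_def gf)
    then show "kernel N G (\<rho> \<circ> g) \<subseteq> group_center N \<inter> derived N (carrier N)"
      using der unfolding ker derN by auto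
  qed (use grpN fin in \<open>auto simp: N_def\<close>)
  with cover have "order N \<le> order H"
    by (auto simp: schur_cover_def)
  moreover have "order N = order K"
    using f by (simp add: order_def N_def card_image)
  ultimately show ?thesis
    by simp
qed

end

theory Submission
  imports Defs "HOL-Algebra.Multiplicative_Group"
begin

text \<open>
  Write \<open>T\<close> for the exterior square of \<open>G\<close> and \<open>M\<close> for the Schur multiplier, the kernel of the
  commutator map of \<open>T\<close>. In a central extension \<open>\<pi>\<close> from \<open>H\<close> to \<open>G\<close> the commutator of two elements
  depends only on their images, so there is a homomorphism from \<open>T\<close> to \<open>H\<close> which sends the wedge of
  \<open>x\<close> and \<open>y\<close> to the commutator of their lifts (\<open>central_extension_wedge_hom\<close>). If the extension is
  stem, this homomorphism maps \<open>M\<close> onto the kernel of \<open>\<pi>\<close>, hence \<open>\<bar>H\<bar> \<le> \<bar>M\<bar> \<bar>G\<bar>\<close>. Suppose that this bound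
  is attained by some stem extension. Then it is attained by every Schur cover, the homomorphism is
  injective on \<open>M\<close> by counting, and the lifts of commuting elements \<open>x\<close>, \<open>y\<close> commute if and only if
  the wedge of \<open>x\<close> and \<open>y\<close> is trivial. So the two graphs agree if and only if all the generators of
  \<open>M0 G\<close> are trivial. As \<open>M\<close> is finite, Lagrange's theorem turns this into an equality of orders.

  It remains to see that \<open>T\<close> is finite and that the bound is attained.

  Finiteness (\<open>finite_exterior_square\<close>) is the argument that proves Schur's theorem on groups with
  centre of finite index: \<open>T\<close> is generated by finitely many wedges, and high powers of a wedge can be
  rewritten as products of fewer wedges.

  For the bound (\<open>stem_extension_full_order_exists\<close>) one has to realise \<open>M\<close> as the kernel of a stem
  extension. Instead of starting from a free presentation of \<open>G\<close>, the extension is grown from \<open>T\<close>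
  itself. Consider groups \<open>W\<close> that contain \<open>T\<close> and have a homomorphism \<open>p\<close> to \<open>G\<close> that extends the
  commutator map, such that the commutator of \<open>u\<close> and \<open>v\<close> in \<open>W\<close> is the wedge of \<open>p u\<close> and \<open>p v\<close>, and such
  that \<open>p\<close> has kernel \<open>M\<close>. The group \<open>T\<close> is an example, with image the derived subgroup of \<open>G\<close>. If
  some \<open>s\<close> is missing from the image, a lift of \<open>s\<close> can be adjoined: conjugation by it has to send \<open>u\<close>
  to \<open>u\<close> times the wedge of \<open>p u\<close> and \<open>s\<close>, the relations of the exterior square make this map an
  endomorphism of \<open>W\<close>, and the corresponding cyclic extension of \<open>W\<close> has the same properties
  (\<open>wedge_extension_step\<close>). After finitely many steps \<open>p\<close> is onto; its kernel \<open>M\<close> is central because a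
  wedge with \<open>\<one>\<close> is trivial, and it lies in \<open>T\<close>, which has become the derived subgroup of \<open>W\<close>.
\<close>

section \<open>Homomorphisms out of a presented group\<close>

lemma (in group) induced_map_hom:
  assumes f: "\<And>x. x \<in> X \<Longrightarrow> f x \<in> carrier G"
    and R: "\<And>u v. (u, v) \<in> R \<Longrightarrow> eval_word G f u = eval_word G f v"
  shows "induced_map G f \<in> hom (presented_group X R) G"
  by (rule homI)
    (auto simp: presented_group_carrier presented_group_mult induced_map_class[OF _ f R]
      eval_word_closed[OF _ f] eval_word_append[OF _ _ f])

lemma presented_group_generated:
  "generate (presented_group X R) ((\<lambda>x. word_class X R [(x, True)]) ` X) =
    carrier (presented_group X R)" (is "generate ?P ?C = _")
proof
  interpret P: group ?P
    by (rule group_presented_group)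
  have one: "\<one>\<^bsub>?P\<^esub> = word_class X R []"
    by (simp add: presented_group_def)
  have C: "?C \<subseteq> carrier ?P"
    by (auto simp: presented_group_carrier words_def)
  then show "generate ?P ?C \<subseteq> carrier ?P"
    by (rule P.generate_incl)
  have letter: "word_class X R [(x, b)] \<in> generate ?P ?C" if "x \<in> X" for x b
  proof (cases b)
    case False
    have "word_class X R [(x, False)] \<otimes>\<^bsub>?P\<^esub> word_class X R [(x, True)] = \<one>\<^bsub>?P\<^esub>"
      using that word_cong_cancel[OF that, of False R]
      by (simp add: presented_group_mult words_def one word_class_eqI)
    then have "word_class X R [(x, False)] = inv\<^bsub>?P\<^esub> word_class X R [(x, True)]"
      using that by (intro P.inv_equality[symmetric]) (auto simp: presented_group_carrier words_def)
    with that False show ?thesis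
      by (auto intro: generate.inv)
  qed (use that in \<open>auto intro: generate.incl\<close>)
  have "word_class X R w \<in> generate ?P ?C" if "w \<in> words X" for w
    using that
  proof (induction w)
    case Nil
    then show ?case
      by (metis one generate.one)
  next
    case (Cons l w)
    then have l: "[l] \<in> words X" "fst l \<in> X" and w: "w \<in> words X"
      by (auto simp: words_def)
    have "word_class X R (l # w) = word_class X R [l] \<otimes>\<^bsub>?P\<^esub> word_class X R w"
      using l w by (simp add: presented_group_mult)
    with Cons.IH[OF w] letter[OF l(2), of "snd l"] show ?case
      by (simp add: generate.eng)
  qed
  then show "carrier ?P \<subseteq> generate ?P ?C"
    by (auto simp: presented_group_carrier)
qed


section \<open>Calculus in the exterior square\<close>

context group
begin

lemma cancel_left:
  "a \<in> carrier G \<Longrightarrow> b \<in> carrier G \<Longrightarrow> inv a \<otimes> (a \<otimes> b) = b"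
  "a \<in> carrier G \<Longrightarrow> b \<in> carrier G \<Longrightarrow> a \<otimes> (inv a \<otimes> b) = b"
  by (simp_all flip: m_assoc)

text \<open>With these rules the simplifier decides equality of group words: everything is expanded,
  associated to the right and freely reduced.\<close>
lemmas group_word_simps = commutator_def conjugate_def m_assoc inv_mult_group cancel_left

lemma conjugate_closed [simp, intro]:
  "x \<in> carrier G \<Longrightarrow> y \<in> carrier G \<Longrightarrow> conjugate G x y \<in> carrier G"
  by (simp add: conjugate_def)

lemma commutator_closed [simp, intro]:
  "x \<in> carrier G \<Longrightarrow> y \<in> carrier G \<Longrightarrow> commutator G x y \<in> carrier G"
  by (simp add: commutator_def)

lemma conjugate_mult:
  "x \<in> carrier G \<Longrightarrow> y \<in> carrier G \<Longrightarrow> g \<in> carrier G \<Longrightarrow>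
    conjugate G (x \<otimes> y) g = conjugate G x g \<otimes> conjugate G y g"
  by (simp add: group_word_simps)

lemma conjugate_conjugate:
  "x \<in> carrier G \<Longrightarrow> g \<in> carrier G \<Longrightarrow> h \<in> carrier G \<Longrightarrow>
    conjugate G (conjugate G x g) h = conjugate G x (g \<otimes> h)"
  by (simp add: group_word_simps)

end

locale group_wedge = group G for G (structure)

sublocale group_wedge \<subseteq> T: group "exterior_square G"
  unfolding exterior_square_def by (rule group_presented_group)

context group_wedge
begin

abbreviation T where "T \<equiv> exterior_square G"
abbreviation d where "d \<equiv> commutator_map G"
abbreviation cj where "cj \<equiv> conjugate G"
abbreviation cm where "cm \<equiv> commutator G"
abbreviation wdg (infix "\<and>\<^sub>G" 75) where "x \<and>\<^sub>G y \<equiv> wedge G x y"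

lemma wedge_closed [simp, intro]:
  "x \<in> carrier G \<Longrightarrow> y \<in> carrier G \<Longrightarrow> x \<and>\<^sub>G y \<in> carrier T"
  by (auto simp: wedge_def exterior_square_def presented_group_carrier words_def)

lemma exterior_square_generated:
  "generate T {x \<and>\<^sub>G y | x y. x \<in> carrier G \<and> y \<in> carrier G} = carrier T"
proof -
  have "{x \<and>\<^sub>G y | x y. x \<in> carrier G \<and> y \<in> carrier G} =
      (\<lambda>p. word_class (carrier G \<times> carrier G) (ext_rels G) [(p, True)]) ` (carrier G \<times> carrier G)"
    by (auto simp: wedge_def)
  then show ?thesis
    unfolding exterior_square_def by (simp add: presented_group_generated)
qed

lemma wedge_mult_left:
  assumes "x \<in> carrier G" "y \<in> carrier G" "z \<in> carrier G"
  shows "(x \<otimes> y) \<and>\<^sub>G z = (cj x y \<and>\<^sub>G cj z y) \<otimes>\<^bsub>T\<^esub> (y \<and>\<^sub>G z)"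
  unfolding wedge_def exterior_square_def using assms
  by (subst presented_group_mult)
    (auto simp: words_def ext_rels_def intro!: word_class_eqI word_cong_rel)

lemma wedge_mult_right:
  assumes "x \<in> carrier G" "y \<in> carrier G" "z \<in> carrier G"
  shows "x \<and>\<^sub>G (y \<otimes> z) = (x \<and>\<^sub>G z) \<otimes>\<^bsub>T\<^esub> (cj x z \<and>\<^sub>G cj y z)"
  unfolding wedge_def exterior_square_def using assms
  by (subst presented_group_mult)
    (auto simp: words_def ext_rels_def intro!: word_class_eqI word_cong_rel)

lemma wedge_self [simp]: "x \<in> carrier G \<Longrightarrow> x \<and>\<^sub>G x = \<one>\<^bsub>T\<^esub>"
proof -
  assume x: "x \<in> carrier G"
  have "\<one>\<^bsub>T\<^esub> = word_class (carrier G \<times> carrier G) (ext_rels G) []"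
    by (simp add: exterior_square_def presented_group_def)
  with x show ?thesis
    unfolding wedge_def
    by (auto simp: words_def ext_rels_def intro!: word_class_eqI word_cong_rel)
qed

lemma exterior_square_induct [consumes 1, case_names one wedge inv mult]:
  assumes "t \<in> carrier T"
    and "P \<one>\<^bsub>T\<^esub>"
    and "\<And>x y. x \<in> carrier G \<Longrightarrow> y \<in> carrier G \<Longrightarrow> P (x \<and>\<^sub>G y)"
    and "\<And>x y. x \<in> carrier G \<Longrightarrow> y \<in> carrier G \<Longrightarrow> P (inv\<^bsub>T\<^esub> (x \<and>\<^sub>G y))"
    and "\<And>t u. t \<in> carrier T \<Longrightarrow> u \<in> carrier T \<Longrightarrow> P t \<Longrightarrow> P u \<Longrightarrow> P (t \<otimes>\<^bsub>T\<^esub> u)"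
  shows "P t"
proof -
  have "t \<in> generate T {x \<and>\<^sub>G y | x y. x \<in> carrier G \<and> y \<in> carrier G}"
    using assms(1) exterior_square_generated by simp
  then show ?thesis
  proof (induction rule: generate.induct)
    case (eng h1 h2)
    then show ?case
      using assms(5) exterior_square_generated by blast
  qed (use assms in auto)
qed

lemma exterior_square_hom_eqI:
  assumes K: "group K" and g: "g \<in> hom T K" and h: "h \<in> hom T K"
    and eq: "\<And>x y. x \<in> carrier G \<Longrightarrow> y \<in> carrier G \<Longrightarrow> g (x \<and>\<^sub>G y) = h (x \<and>\<^sub>G y)"
    and t: "t \<in> carrier T"
  shows "g t = h t"
proof -
  interpret g: group_hom T K g
    using K g by (simp add: group_hom_def group_hom_axioms_def T.group_axioms)
  interpret h: group_hom T K h
    using K h by (simp add: group_hom_def group_hom_axioms_def T.group_axioms)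
  show ?thesis
    using t by (induction rule: exterior_square_induct) (simp_all add: eq)
qed

text \<open>The universal property of the exterior square.\<close>
lemma exterior_square_lift:
  assumes K: "group K"
    and f: "\<And>x y. x \<in> carrier G \<Longrightarrow> y \<in> carrier G \<Longrightarrow> f x y \<in> carrier K"
    and f1: "\<And>x y z. x \<in> carrier G \<Longrightarrow> y \<in> carrier G \<Longrightarrow> z \<in> carrier G \<Longrightarrow>
      f (x \<otimes> y) z = f (cj x y) (cj z y) \<otimes>\<^bsub>K\<^esub> f y z"
    and f2: "\<And>x y z. x \<in> carrier G \<Longrightarrow> y \<in> carrier G \<Longrightarrow> z \<in> carrier G \<Longrightarrow>
      f x (y \<otimes> z) = f x z \<otimes>\<^bsub>K\<^esub> f (cj x z) (cj y z)"
    and f3: "\<And>x. x \<in> carrier G \<Longrightarrow> f x x = \<one>\<^bsub>K\<^esub>"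
  obtains h where "h \<in> hom T K"
    and "\<And>x y. x \<in> carrier G \<Longrightarrow> y \<in> carrier G \<Longrightarrow> h (x \<and>\<^sub>G y) = f x y"
proof
  interpret K: group K by (rule K)
  let ?f = "\<lambda>(x, y). f x y"
  have f': "?f p \<in> carrier K" if "p \<in> carrier G \<times> carrier G" for p
    using that f by auto
  have R: "eval_word K ?f u = eval_word K ?f v" if "(u, v) \<in> ext_rels G" for u v
    using that unfolding ext_rels_def
    by (auto simp: eval_word_def f f1 f2 f3)
  show "induced_map K ?f \<in> hom T K"
    unfolding exterior_square_def by (rule K.induced_map_hom[OF f' R])
  show "induced_map K ?f (x \<and>\<^sub>G y) = f x y" if "x \<in> carrier G" "y \<in> carrier G" for x y
    unfolding wedge_def using that
    by (subst K.induced_map_class[OF _ f' R]) (auto simp: words_def eval_word_def f)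
qed

lemma wedge_one [simp]:
  assumes "x \<in> carrier G"
  shows "\<one> \<and>\<^sub>G x = \<one>\<^bsub>T\<^esub>" "x \<and>\<^sub>G \<one> = \<one>\<^bsub>T\<^esub>"
  using wedge_mult_left[of \<one> \<one> x] wedge_mult_right[of x \<one> \<one>] assms
  by (simp_all add: conjugate_def)

text \<open>For bilinear alternating maps one expands the square of a sum. Here the wedge of
  \<open>z \<otimes> y\<close> with itself is expanded, where \<open>z\<close> is chosen such that conjugation by \<open>y\<close> turns it
  into \<open>x\<close>.\<close>
lemma wedge_swap:
  assumes x: "x \<in> carrier G" and y: "y \<in> carrier G"
  shows "(x \<and>\<^sub>G y) \<otimes>\<^bsub>T\<^esub> (y \<and>\<^sub>G x) = \<one>\<^bsub>T\<^esub>"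
proof -
  define z where "z = y \<otimes> x \<otimes> inv y"
  have z: "z \<in> carrier G" and zx: "cj z y = x" and yy: "cj y y = y"
    using x y by (simp_all add: z_def group_word_simps)
  have zy: "cj (z \<otimes> y) y = x \<otimes> y"
    using x y by (simp add: z_def group_word_simps)
  have "x \<and>\<^sub>G (x \<otimes> y) = x \<and>\<^sub>G y" "y \<and>\<^sub>G (z \<otimes> y) = y \<and>\<^sub>G x"
    using wedge_mult_right[of x x y] wedge_mult_right[of y z y] x y z by (simp_all add: zx yy)
  then show ?thesis
    using wedge_mult_left[of z y "z \<otimes> y"] x y z by (simp add: zx zy)
qed

text \<open>The group acts on its exterior square from the right, through conjugation of both entries.
  Together with this action the commutator map is a crossed module; \<open>peiffer\<close> below is
  the identity that this requires.\<close>
definition act where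
  "act g = induced_map T (\<lambda>(x, y). cj x g \<and>\<^sub>G cj y g)"

lemma
  assumes g: "g \<in> carrier G"
  shows act_hom: "act g \<in> hom T T"
    and act_wedge: "x \<in> carrier G \<Longrightarrow> y \<in> carrier G \<Longrightarrow> act g (x \<and>\<^sub>G y) = cj x g \<and>\<^sub>G cj y g"
proof -
  let ?f = "\<lambda>(x, y). cj x g \<and>\<^sub>G cj y g"
  have f': "?f p \<in> carrier T" if "p \<in> carrier G \<times> carrier G" for p
    using that g by auto
  have swap: "cj (cj x y) g = cj (cj x g) (cj y g)" if "x \<in> carrier G" "y \<in> carrier G" for x y
    using that g by (simp add: group_word_simps)
  have R: "eval_word T ?f u = eval_word T ?f v" if "(u, v) \<in> ext_rels G" for u v
    using that g unfolding ext_rels_def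
    by (auto simp: eval_word_def conjugate_mult wedge_mult_left wedge_mult_right swap)
  show "act g \<in> hom T T"
    unfolding act_def by (subst (1) exterior_square_def) (rule T.induced_map_hom[OF f' R])
  show "act g (x \<and>\<^sub>G y) = cj x g \<and>\<^sub>G cj y g" if "x \<in> carrier G" "y \<in> carrier G" for x y
    unfolding act_def wedge_def[of G x y] using that g
    by (subst T.induced_map_class[OF _ f' R]) (auto simp: words_def eval_word_def)
qed

lemma act_group_hom: "g \<in> carrier G \<Longrightarrow> group_hom T T (act g)"
  by (simp add: group_hom_def group_hom_axioms_def act_hom T.group_axioms)

lemma act_closed [simp, intro]: "g \<in> carrier G \<Longrightarrow> t \<in> carrier T \<Longrightarrow> act g t \<in> carrier T"
  using act_hom by (auto simp: hom_def)

lemma act_mult: "g \<in> carrier G \<Longrightarrow> t \<in> carrier T \<Longrightarrow> u \<in> carrier T \<Longrightarrow>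
    act g (t \<otimes>\<^bsub>T\<^esub> u) = act g t \<otimes>\<^bsub>T\<^esub> act g u"
  using act_hom by (auto simp: hom_def)

lemma act_act:
  assumes g: "g \<in> carrier G" and h: "h \<in> carrier G" and t: "t \<in> carrier T"
  shows "act h (act g t) = act (g \<otimes> h) t"
proof (rule exterior_square_hom_eqI[OF T.group_axioms _ _ _ t, of "\<lambda>t. act h (act g t)"])
  show "(\<lambda>t. act h (act g t)) \<in> hom T T"
    using g h by (intro homI) (auto simp: act_mult)
qed (use g h in \<open>simp_all add: act_hom act_wedge conjugate_conjugate\<close>)

lemma act_one: "t \<in> carrier T \<Longrightarrow> act \<one> t = t"
  by (rule exterior_square_hom_eqI[OF T.group_axioms, of _ "\<lambda>t. t"])
    (auto simp: act_hom act_wedge conjugate_def intro: homI)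

sublocale d: group_hom T G d
  by (simp add: group_hom_def group_hom_axioms_def commutator_map_hom T.group_axioms group_axioms)

lemma d_wedge [simp]: "x \<in> carrier G \<Longrightarrow> y \<in> carrier G \<Longrightarrow> d (x \<and>\<^sub>G y) = cm x y"
  by (rule commutator_map_wedge)

lemma wedge_mult_left_act:
  assumes "x \<in> carrier G" "y \<in> carrier G" "z \<in> carrier G"
  shows "(x \<otimes> y) \<and>\<^sub>G z = act y (x \<and>\<^sub>G z) \<otimes>\<^bsub>T\<^esub> (y \<and>\<^sub>G z)"
  using assms by (simp add: wedge_mult_left act_wedge)

lemma wedge_mult_right_act:
  assumes "x \<in> carrier G" "y \<in> carrier G" "z \<in> carrier G"
  shows "x \<and>\<^sub>G (y \<otimes> z) = (x \<and>\<^sub>G z) \<otimes>\<^bsub>T\<^esub> act z (x \<and>\<^sub>G y)"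
  using assms by (simp add: wedge_mult_right act_wedge)

text \<open>The right factor is expanded before the left one. The opposite order gives a second expansion,
  and comparing the two yields the rule for conjugation by a wedge.\<close>
lemma wedge_mult_mult:
  assumes "x \<in> carrier G" "y \<in> carrier G" "z \<in> carrier G" "w \<in> carrier G"
  shows "(x \<otimes> y) \<and>\<^sub>G (z \<otimes> w) =
    act y (x \<and>\<^sub>G w) \<otimes>\<^bsub>T\<^esub> (y \<and>\<^sub>G w) \<otimes>\<^bsub>T\<^esub> act (y \<otimes> w) (x \<and>\<^sub>G z) \<otimes>\<^bsub>T\<^esub> act w (y \<and>\<^sub>G z)"
  using assms
  by (subst wedge_mult_right_act) (simp_all add: wedge_mult_left_act act_mult act_act T.m_assoc)

lemma wedge_conjugation:
  assumes x: "x \<in> carrier G" and y: "y \<in> carrier G" and t: "t \<in> carrier T"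
  shows "t \<otimes>\<^bsub>T\<^esub> (x \<and>\<^sub>G y) = (x \<and>\<^sub>G y) \<otimes>\<^bsub>T\<^esub> act (cm x y) t"
proof -
  have key: "act (y \<otimes> x) (a \<and>\<^sub>G b) \<otimes>\<^bsub>T\<^esub> (x \<and>\<^sub>G y) = (x \<and>\<^sub>G y) \<otimes>\<^bsub>T\<^esub> act (x \<otimes> y) (a \<and>\<^sub>G b)"
    if a: "a \<in> carrier G" and b: "b \<in> carrier G" for a b
  proof -
    have "(a \<otimes> x) \<and>\<^sub>G (b \<otimes> y) = act x (a \<and>\<^sub>G (b \<otimes> y)) \<otimes>\<^bsub>T\<^esub> (x \<and>\<^sub>G (b \<otimes> y))"
      using a b x y by (intro wedge_mult_left_act) simp_all
    also have "\<dots> = act x (a \<and>\<^sub>G y) \<otimes>\<^bsub>T\<^esub> act (y \<otimes> x) (a \<and>\<^sub>G b) \<otimes>\<^bsub>T\<^esub>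
        ((x \<and>\<^sub>G y) \<otimes>\<^bsub>T\<^esub> act y (x \<and>\<^sub>G b))"
      using a b x y by (simp add: wedge_mult_right_act act_mult act_act)
    finally have "act x (a \<and>\<^sub>G y) \<otimes>\<^bsub>T\<^esub> (act (y \<otimes> x) (a \<and>\<^sub>G b) \<otimes>\<^bsub>T\<^esub> (x \<and>\<^sub>G y) \<otimes>\<^bsub>T\<^esub> act y (x \<and>\<^sub>G b)) =
        act x (a \<and>\<^sub>G y) \<otimes>\<^bsub>T\<^esub> ((x \<and>\<^sub>G y) \<otimes>\<^bsub>T\<^esub> act (x \<otimes> y) (a \<and>\<^sub>G b) \<otimes>\<^bsub>T\<^esub> act y (x \<and>\<^sub>G b))"
      using a b x y by (simp add: wedge_mult_mult T.m_assoc)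
    then show ?thesis
      using a b x y by simp
  qed
  have "inv\<^bsub>T\<^esub> (x \<and>\<^sub>G y) \<otimes>\<^bsub>T\<^esub> t \<otimes>\<^bsub>T\<^esub> (x \<and>\<^sub>G y) = act (cm x y) t"
  proof (rule exterior_square_hom_eqI[OF T.group_axioms _ act_hom _ t])
    show "(\<lambda>t. inv\<^bsub>T\<^esub> (x \<and>\<^sub>G y) \<otimes>\<^bsub>T\<^esub> t \<otimes>\<^bsub>T\<^esub> (x \<and>\<^sub>G y)) \<in> hom T T"
      using x y by (intro homI) (simp_all add: T.m_assoc, simp flip: T.m_assoc)
    fix a b assume a: "a \<in> carrier G" and b: "b \<in> carrier G"
    \<comment> \<open>Applied to entries conjugated by \<open>g\<close>, the left side of \<open>key\<close> loses its action, and the action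
        that is left on the right is that of \<open>inv (y \<otimes> x) \<otimes> (x \<otimes> y)\<close>, the commutator.\<close>
    define g where "g = inv (y \<otimes> x)"
    have g: "g \<in> carrier G"
      using x y by (simp add: g_def)
    have "(a \<and>\<^sub>G b) \<otimes>\<^bsub>T\<^esub> (x \<and>\<^sub>G y) = (x \<and>\<^sub>G y) \<otimes>\<^bsub>T\<^esub> act (cm x y) (a \<and>\<^sub>G b)"
      using key[of "cj a g" "cj b g"] x y a b g
      by (simp add: act_act flip: act_wedge) (simp add: g_def act_one group_word_simps)
    then show "inv\<^bsub>T\<^esub> (x \<and>\<^sub>G y) \<otimes>\<^bsub>T\<^esub> (a \<and>\<^sub>G b) \<otimes>\<^bsub>T\<^esub> (x \<and>\<^sub>G y) = act (cm x y) (a \<and>\<^sub>G b)"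
      using x y a b by (simp add: T.m_assoc) (simp flip: T.m_assoc)
  qed (use x y in auto)
  then show ?thesis
    using x y t by (metis T.inv_solve_left T.m_assoc T.m_closed T.inv_closed wedge_closed)
qed

lemma peiffer:
  assumes u: "u \<in> carrier T" and t: "t \<in> carrier T"
  shows "t \<otimes>\<^bsub>T\<^esub> u = u \<otimes>\<^bsub>T\<^esub> act (d u) t"
  using u t
proof (induction arbitrary: t rule: exterior_square_induct)
  case one
  then show ?case by (simp add: act_one)
next
  case (wedge x y)
  then show ?case by (simp add: wedge_conjugation)
next
  case (inv x y)
  let ?c = "cm x y" and ?w = "x \<and>\<^sub>G y"
  have "act (inv ?c) t \<otimes>\<^bsub>T\<^esub> ?w = ?w \<otimes>\<^bsub>T\<^esub> t"
    using inv by (simp add: wedge_conjugation act_act act_one)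
  then have "t \<otimes>\<^bsub>T\<^esub> inv\<^bsub>T\<^esub> ?w = inv\<^bsub>T\<^esub> ?w \<otimes>\<^bsub>T\<^esub> act (inv ?c) t"
    using inv by (metis T.inv_solve_left T.inv_solve_right T.m_assoc T.m_closed T.inv_closed
        act_closed commutator_closed inv_closed wedge_closed)
  with inv show ?case by simp
next
  case (mult v u)
  have "t \<otimes>\<^bsub>T\<^esub> (v \<otimes>\<^bsub>T\<^esub> u) = v \<otimes>\<^bsub>T\<^esub> (act (d v) t \<otimes>\<^bsub>T\<^esub> u)"
    using mult.IH(1)[OF mult.prems] \<open>v \<in> carrier T\<close> \<open>u \<in> carrier T\<close> mult.prems
    by (simp flip: T.m_assoc)
  also have "\<dots> = v \<otimes>\<^bsub>T\<^esub> (u \<otimes>\<^bsub>T\<^esub> act (d u) (act (d v) t))"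
    using mult.IH(2)[of "act (d v) t"] mult.prems \<open>v \<in> carrier T\<close> by simp
  finally show ?case
    using \<open>v \<in> carrier T\<close> \<open>u \<in> carrier T\<close> mult.prems by (simp add: act_act T.m_assoc)
qed

text \<open>Both sides are homomorphisms in \<open>t\<close>, the right one by the Peiffer identity, so it suffices to
  compare them on a wedge of \<open>x\<close> and \<open>y\<close>. There the claim follows by expanding the wedge of \<open>x\<close>
  and \<open>y \<otimes> s\<close>, once directly and once after writing \<open>y \<otimes> s\<close> as a conjugate of \<open>s\<close> times \<open>y\<close>.\<close>
lemma act_eq_mult_wedge:
  assumes t: "t \<in> carrier T" and s: "s \<in> carrier G"
  shows "act s t = t \<otimes>\<^bsub>T\<^esub> (d t \<and>\<^sub>G s)"
proof (rule exterior_square_hom_eqI[OF T.group_axioms act_hom _ _ t])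
  show "(\<lambda>t. t \<otimes>\<^bsub>T\<^esub> (d t \<and>\<^sub>G s)) \<in> hom T T"
  proof (rule homI)
    fix t u assume t: "t \<in> carrier T" and u: "u \<in> carrier T"
    have "t \<otimes>\<^bsub>T\<^esub> u \<otimes>\<^bsub>T\<^esub> (d (t \<otimes>\<^bsub>T\<^esub> u) \<and>\<^sub>G s) =
        t \<otimes>\<^bsub>T\<^esub> (u \<otimes>\<^bsub>T\<^esub> act (d u) (d t \<and>\<^sub>G s)) \<otimes>\<^bsub>T\<^esub> (d u \<and>\<^sub>G s)"
      using t u s by (simp add: wedge_mult_left_act T.m_assoc)
    also have "u \<otimes>\<^bsub>T\<^esub> act (d u) (d t \<and>\<^sub>G s) = (d t \<and>\<^sub>G s) \<otimes>\<^bsub>T\<^esub> u"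
      using t u s by (simp add: peiffer[symmetric])
    finally show "t \<otimes>\<^bsub>T\<^esub> u \<otimes>\<^bsub>T\<^esub> (d (t \<otimes>\<^bsub>T\<^esub> u) \<and>\<^sub>G s) =
        t \<otimes>\<^bsub>T\<^esub> (d t \<and>\<^sub>G s) \<otimes>\<^bsub>T\<^esub> (u \<otimes>\<^bsub>T\<^esub> (d u \<and>\<^sub>G s))"
      using t u s by (simp add: T.m_assoc)
  qed (use s in simp)
  fix x y assume x: "x \<in> carrier G" and y: "y \<in> carrier G"
  let ?c = "cm x y"
  have "x \<otimes> ?c = cj x y"
    using x y by (simp add: group_word_simps)
  then have "cj x y \<and>\<^sub>G s = act ?c (x \<and>\<^sub>G s) \<otimes>\<^bsub>T\<^esub> (?c \<and>\<^sub>G s)"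
    using wedge_mult_left_act[of x ?c s] x y s by simp
  then have "(x \<and>\<^sub>G y) \<otimes>\<^bsub>T\<^esub> (cj x y \<and>\<^sub>G s) = (x \<and>\<^sub>G y) \<otimes>\<^bsub>T\<^esub> act ?c (x \<and>\<^sub>G s) \<otimes>\<^bsub>T\<^esub> (?c \<and>\<^sub>G s)"
    using x y s by (simp add: T.m_assoc)
  also have "\<dots> = (x \<and>\<^sub>G s) \<otimes>\<^bsub>T\<^esub> ((x \<and>\<^sub>G y) \<otimes>\<^bsub>T\<^esub> (?c \<and>\<^sub>G s))"
    using x y s by (simp add: wedge_conjugation[symmetric] T.m_assoc)
  finally have 1: "(x \<and>\<^sub>G y) \<otimes>\<^bsub>T\<^esub> (cj x y \<and>\<^sub>G s) = (x \<and>\<^sub>G s) \<otimes>\<^bsub>T\<^esub> ((x \<and>\<^sub>G y) \<otimes>\<^bsub>T\<^esub> (?c \<and>\<^sub>G s))" .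
  define r where "r = y \<otimes> s \<otimes> inv y"
  have r: "r \<in> carrier G" "cj r y = s" "r \<otimes> y = y \<otimes> s"
    using y s by (simp_all add: r_def group_word_simps)
  have "(x \<and>\<^sub>G y) \<otimes>\<^bsub>T\<^esub> (cj x y \<and>\<^sub>G s) = (x \<and>\<^sub>G s) \<otimes>\<^bsub>T\<^esub> act s (x \<and>\<^sub>G y)"
    using wedge_mult_right[of x r y] wedge_mult_right_act[of x y s] r x y s by simp
  with 1 show "act s (x \<and>\<^sub>G y) = (x \<and>\<^sub>G y) \<otimes>\<^bsub>T\<^esub> (d (x \<and>\<^sub>G y) \<and>\<^sub>G s)"
    using x y s by simp
qed (use s in auto)

end


section \<open>Finiteness of the exterior square\<close>

context group
begin

definition prods where "prods ws = foldr (\<otimes>) ws \<one>"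

lemma prods_simps [simp]: "prods [] = \<one>" "prods (c # ws) = c \<otimes> prods ws"
  by (simp_all add: prods_def)

lemma prods_closed [simp, intro]: "set ws \<subseteq> carrier G \<Longrightarrow> prods ws \<in> carrier G"
  by (induction ws) auto

lemma prods_append: "set vs \<subseteq> carrier G \<Longrightarrow> set ws \<subseteq> carrier G \<Longrightarrow>
    prods (vs @ ws) = prods vs \<otimes> prods ws"
  by (induction vs) (auto simp: m_assoc)

text \<open>An occurrence of \<open>c\<close> can be moved to the front at the price of conjugating the letters that it
  passes; neither the length nor the set of admissible letters changes, and passing another \<open>c\<close>
  leaves that one unaffected.\<close>
lemma prods_collect_power:
  assumes C: "C \<subseteq> carrier G"
    and conj: "\<And>a c. a \<in> C \<Longrightarrow> c \<in> C \<Longrightarrow> inv c \<otimes> a \<otimes> c \<in> C"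
    and c: "c \<in> C"
  shows "set ws \<subseteq> C \<Longrightarrow> k \<le> count_list ws c \<Longrightarrow>
    \<exists>us. set us \<subseteq> C \<and> length us + k = length ws \<and> prods ws = c [^] k \<otimes> prods us"
proof (induction ws arbitrary: k)
  case Nil
  then show ?case by auto
next
  case (Cons a ws)
  have cG: "c \<in> carrier G" and aG: "a \<in> carrier G" and aC: "a \<in> C"
    using C c Cons.prems by auto
  show ?case
  proof (cases "k = 0")
    case True
    then show ?thesis
      using Cons.prems C aG prods_closed[of ws] by (intro exI[of _ "a # ws"]) auto
  next
    case False
    then obtain l where k: "k = Suc l" by (cases k) auto
    show ?thesis
    proof (cases "a = c")
      case True
      then obtain us where us: "set us \<subseteq> C" "length us + l = length ws" "prods ws = c [^] l \<otimes> prods us"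
        using Cons.IH[of l] Cons.prems k by auto
      moreover have "c \<otimes> (c [^] l \<otimes> prods us) = c [^] k \<otimes> prods us"
        using us(1) cG C prods_closed[of us] nat_pow_Suc2[OF cG, of l] by (simp add: k flip: m_assoc)
      ultimately show ?thesis
        using True k by (intro exI[of _ us]) simp
    next
      case False
      then obtain us where us: "set us \<subseteq> C" "length us + k = length ws" "prods ws = c [^] k \<otimes> prods us"
        using Cons.IH[of k] Cons.prems by auto
      have conj_pow: "inv (c [^] j) \<otimes> a \<otimes> c [^] j \<in> C" for j :: nat
      proof (induction j)
        case 0
        then show ?case using aC aG by simp
      next
        case (Suc j)
        then show ?case
          using conj[OF Suc c] cG aG by (simp add: inv_mult_group m_assoc)
      qed
      have "prods (a # ws) = c [^] k \<otimes> prods ((inv (c [^] k) \<otimes> a \<otimes> c [^] k) # us)"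
        using us cG aG C by (simp add: m_assoc prods_closed[OF subset_trans]) (simp flip: m_assoc add: prods_closed[OF subset_trans])
      then show ?thesis
        using us conj_pow[of k] by (intro exI[of _ "(inv (c [^] k) \<otimes> a \<otimes> c [^] k) # us"]) auto
    qed
  qed
qed

text \<open>A product of more than \<open>n * card C\<close> letters contains some letter \<open>Suc n\<close> times. These occurrences
  can be collected in front and replaced by \<open>n\<close> letters, so every element is a product of at most
  \<open>n * card C\<close> letters.\<close>
lemma finite_if_generators_powers_shorten:
  assumes C: "C \<subseteq> carrier G" and fin: "finite C"
    and conj: "\<And>a c. a \<in> C \<Longrightarrow> c \<in> C \<Longrightarrow> inv c \<otimes> a \<otimes> c \<in> C"
    and inv: "\<And>c. c \<in> C \<Longrightarrow> inv c \<in> C"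
    and gen: "generate G C = carrier G"
    and pow: "\<And>c. c \<in> C \<Longrightarrow> \<exists>us. set us \<subseteq> C \<and> length us = n \<and> c [^] Suc n = prods us"
  shows "finite (carrier G)"
proof -
  let ?L = "{ws. set ws \<subseteq> C \<and> length ws \<le> n * card C}"
  have short: "\<exists>us\<in>?L. prods ws = prods us" if "set ws \<subseteq> C" for ws
    using that
  proof (induction "length ws" arbitrary: ws rule: less_induct)
    case less
    show ?case
    proof (cases "length ws \<le> n * card C")
      case False
      have "\<exists>c\<in>C. Suc n \<le> count_list ws c"
      proof (rule ccontr)
        assume "\<not> ?thesis"
        then have "sum (count_list ws) C \<le> (\<Sum>c\<in>C. n)"
          by (intro sum_mono) (auto simp: not_less_eq_eq)
        with False less.prems fin show False
          by (simp add: sum_count_set mult.commute)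
      qed
      then obtain c where c: "c \<in> C" "Suc n \<le> count_list ws c" by blast
      from prods_collect_power[OF C conj c(1) less.prems c(2)] obtain us
        where us: "set us \<subseteq> C" "length us + Suc n = length ws" "prods ws = c [^] Suc n \<otimes> prods us"
        by blast
      from pow[OF c(1)] obtain vs where vs: "set vs \<subseteq> C" "length vs = n" "c [^] Suc n = prods vs"
        by blast
      have "prods ws = prods (vs @ us)"
        using us vs C by (simp add: prods_append)
      moreover have "length (vs @ us) < length ws" "set (vs @ us) \<subseteq> C"
        using us vs by auto
      ultimately show ?thesis
        using less.hyps[of "vs @ us"] by metis
    qed (use less.prems in auto)
  qed
  have "\<exists>ws. set ws \<subseteq> C \<and> g = prods ws" if "g \<in> generate G C" for g
    using that
  proof (induction rule: generate.induct)
    case one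
    show ?case by (intro exI[of _ "[]"]) simp
  next
    case (incl h)
    then show ?case using C by (intro exI[of _ "[h]"]) auto
  next
    case (inv h)
    then show ?case using C assms(4) by (intro exI[of _ "[inv h]"]) auto
  next
    case (eng g h)
    then obtain us vs where "set us \<subseteq> C" "g = prods us" "set vs \<subseteq> C" "h = prods vs" by blast
    then show ?case
      using C by (intro exI[of _ "us @ vs"]) (auto simp: prods_append)
  qed
  then have "carrier G \<subseteq> prods ` ?L"
    unfolding gen[symmetric] using short by (smt (verit, best) image_iff subsetI)
  then show ?thesis
    using finite_lists_length_le[OF fin] by (meson finite_imageI finite_subset)
qed

end

context group_wedge
begin

lemma act_kernel:
  assumes "m \<in> kernel T G d" "g \<in> carrier G"
  shows "act g m = m"
  using act_eq_mult_wedge[of m g] assms by (simp add: kernel_def)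

lemma act_pow: "g \<in> carrier G \<Longrightarrow> t \<in> carrier T \<Longrightarrow> act g (t [^]\<^bsub>T\<^esub> (n :: nat)) = act g t [^]\<^bsub>T\<^esub> n"
  using group_hom.hom_nat_pow[OF act_group_hom] .

lemma inv_wedge: "x \<in> carrier G \<Longrightarrow> y \<in> carrier G \<Longrightarrow> inv\<^bsub>T\<^esub> (x \<and>\<^sub>G y) = y \<and>\<^sub>G x"
  by (rule T.inv_equality) (simp_all add: wedge_swap)

text \<open>The generators are the wedges, and the exponent is the order \<open>n\<close> of the group. For a wedge \<open>c\<close> of
  \<open>x\<close> and \<open>y\<close> the power \<open>c\<^sup>n\<close> lies in the kernel of the commutator map and is therefore fixed by the action
  of \<open>y\<close>. So \<open>c\<close> times \<open>c\<^sup>n\<close> is also \<open>c\<close> times the \<open>n\<close>-th power of \<open>act y c\<close>. The product of \<open>c\<close> and the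
  first of these factors is the wedge of \<open>x\<close> and \<open>y \<otimes> y\<close>, which saves one letter.\<close>
lemma finite_exterior_square:
  assumes fin: "finite (carrier G)"
  shows "finite (carrier T)"
proof -
  define C where "C = {x \<and>\<^sub>G y | x y. x \<in> carrier G \<and> y \<in> carrier G}"
  have C: "C \<subseteq> carrier T"
    by (auto simp: C_def)
  have "C = (\<lambda>(x, y). x \<and>\<^sub>G y) ` (carrier G \<times> carrier G)"
    by (auto simp: C_def)
  then have finC: "finite C"
    using fin by simp
  obtain n where n: "order G = Suc n"
    using fin one_closed order_gt_0_iff_finite not0_implies_Suc by (metis not_gr_zero)
  show ?thesis
  proof (rule T.finite_if_generators_powers_shorten[OF C finC, where n = "order G"])
    fix c assume c: "c \<in> C"
    then obtain x y where xy: "x \<in> carrier G" "y \<in> carrier G" "c = x \<and>\<^sub>G y"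
      by (auto simp: C_def)
    show "inv\<^bsub>T\<^esub> c \<in> C"
      using xy by (auto simp: inv_wedge C_def)
    show "inv\<^bsub>T\<^esub> c \<otimes>\<^bsub>T\<^esub> a \<otimes>\<^bsub>T\<^esub> c \<in> C" if a: "a \<in> C" for a
    proof -
      have aT: "a \<in> carrier T" and cT: "c \<in> carrier T"
        using a c C by auto
      then have "inv\<^bsub>T\<^esub> c \<otimes>\<^bsub>T\<^esub> a \<otimes>\<^bsub>T\<^esub> c = inv\<^bsub>T\<^esub> c \<otimes>\<^bsub>T\<^esub> (c \<otimes>\<^bsub>T\<^esub> act (d c) a)"
        by (simp add: T.m_assoc peiffer[of c a])
      then have "inv\<^bsub>T\<^esub> c \<otimes>\<^bsub>T\<^esub> a \<otimes>\<^bsub>T\<^esub> c = act (d c) a"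
        using aT cT by (simp flip: T.m_assoc)
      with a c C show ?thesis
        by (fastforce simp: C_def act_wedge)
    qed
    have cT: "c \<in> carrier T" "act y c \<in> carrier T"
      using xy by auto
    have "d (c [^]\<^bsub>T\<^esub> order G) = \<one>"
      using cT fin by (simp add: d.hom_nat_pow pow_order_eq_1)
    then have "c [^]\<^bsub>T\<^esub> order G \<in> kernel T G d"
      using cT by (simp add: kernel_def)
    then have "c [^]\<^bsub>T\<^esub> order G = act y c [^]\<^bsub>T\<^esub> order G"
      using act_kernel xy cT by (simp flip: act_pow)
    then have "c [^]\<^bsub>T\<^esub> Suc (order G) = c \<otimes>\<^bsub>T\<^esub> (act y c \<otimes>\<^bsub>T\<^esub> act y c [^]\<^bsub>T\<^esub> n)"
      using cT by (subst T.nat_pow_Suc2, simp) (simp only: n T.nat_pow_Suc2)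
    also have "\<dots> = (x \<and>\<^sub>G (y \<otimes> y)) \<otimes>\<^bsub>T\<^esub> act y c [^]\<^bsub>T\<^esub> n"
      using xy cT by (simp add: wedge_mult_right_act T.m_assoc)
    also have "act y c [^]\<^bsub>T\<^esub> n = T.prods (replicate n (act y c))"
    proof (induction n)
      case (Suc k)
      then show ?case
        using cT T.nat_pow_Suc2[of "act y c" k] by simp
    qed simp
    finally have "c [^]\<^bsub>T\<^esub> Suc (order G) =
        T.prods ((x \<and>\<^sub>G (y \<otimes> y)) # replicate n (act y c))"
      by simp
    moreover have "x \<and>\<^sub>G (y \<otimes> y) \<in> C" "act y c \<in> C"
      using xy by (simp_all add: C_def act_wedge, blast+)
    ultimately show "\<exists>us. set us \<subseteq> C \<and> length us = order G \<and> c [^]\<^bsub>T\<^esub> Suc (order G) = T.prods us"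
      using n by (intro exI[of _ "(x \<and>\<^sub>G (y \<otimes> y)) # replicate n (act y c)"]) auto
  qed (use exterior_square_generated C_def in auto)
qed

end


section \<open>Cyclic extensions\<close>

text \<open>The pair \<open>(i, u)\<close> stands for the product of the \<open>i\<close>-th power of a new element and \<open>u\<close>. The new
  element conjugates \<open>W\<close> by \<open>\<phi>\<close>, and its \<open>n\<close>-th power is \<open>c\<close>, which accounts for the carry.\<close>
definition cyclic_extension ::
  "('w, 'k) monoid_scheme \<Rightarrow> ('w \<Rightarrow> 'w) \<Rightarrow> nat \<Rightarrow> 'w \<Rightarrow> (nat \<times> 'w) monoid" where
  "cyclic_extension W \<phi> n c =
    \<lparr>carrier = {..<n} \<times> carrier W,
     mult = (\<lambda>(i, u) (j, v). ((i + j) mod n,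
       c [^]\<^bsub>W\<^esub> ((i + j) div n) \<otimes>\<^bsub>W\<^esub> (\<phi> ^^ j) u \<otimes>\<^bsub>W\<^esub> v)),
     one = (0, \<one>\<^bsub>W\<^esub>)\<rparr>"

lemma div_add_mod_div: "((a + b) mod n + e) div n + (a + b) div n = (a + b + e) div (n :: nat)"
proof (cases "n = 0")
  case False
  have "a + b + e = (a + b) div n * n + ((a + b) mod n + e)"
    by simp
  then have "(a + b + e) div n = ((a + b) div n * n + ((a + b) mod n + e)) div n"
    by presburger
  also have "\<dots> = (a + b) div n + ((a + b) mod n + e) div n"
    using False by (rule div_mult_self3)
  finally show ?thesis by simp
qed simp

text \<open>The two conditions on \<open>c\<close> say what has to hold for an \<open>n\<close>-th power of an element that induces
  \<open>\<phi>\<close>: it commutes with that element and induces the \<open>n\<close>-th power of \<open>\<phi>\<close>. They also make \<open>\<phi>\<close>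
  surjective, whence the inverses.\<close>
lemma (in group) group_cyclic_extension:
  assumes hom: "\<phi> \<in> hom G G" and n: "0 < n" and c: "c \<in> carrier G" and \<phi>c: "\<phi> c = c"
    and inner: "\<And>u. u \<in> carrier G \<Longrightarrow> c \<otimes> (\<phi> ^^ n) u = u \<otimes> c"
  shows "group (cyclic_extension G \<phi> n c)"
proof -
  let ?E = "cyclic_extension G \<phi> n c"
  have pow_hom: "\<phi> ^^ k \<in> hom G G" for k
  proof (induction k)
    case (Suc k)
    then show ?case
      using hom by (intro homI) (simp_all add: hom_in_carrier hom_mult)
  qed (simp add: hom_def)
  have cl [simp]: "(\<phi> ^^ k) u \<in> carrier G" if "u \<in> carrier G" for k u
    using that pow_hom[of k] by (auto simp: hom_def)
  have mult [simp]: "(\<phi> ^^ k) (u \<otimes> v) = (\<phi> ^^ k) u \<otimes> (\<phi> ^^ k) v"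
    if "u \<in> carrier G" "v \<in> carrier G" for k u v
    using that pow_hom[of k] by (auto simp: hom_def)
  have fix_c [simp]: "(\<phi> ^^ k) c = c" for k
    by (induction k) (simp_all add: \<phi>c)
  have fix_pow [simp]: "(\<phi> ^^ k) (c [^] (j :: nat)) = c [^] j" for k j
    by (induction j) (use c pow_hom[of k] in \<open>auto simp: hom_one[OF _ group_axioms group_axioms]\<close>)
  have inner_pow: "c [^] k \<otimes> (\<phi> ^^ (k * n + q)) u = (\<phi> ^^ q) u \<otimes> c [^] k"
    if u: "u \<in> carrier G" for k q u
  proof (induction k)
    case (Suc k)
    have "c [^] Suc k \<otimes> (\<phi> ^^ (Suc k * n + q)) u = c [^] k \<otimes> (c \<otimes> (\<phi> ^^ n) ((\<phi> ^^ (k * n + q)) u))"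
      using u c by (simp add: m_assoc funpow_add)
    also have "\<dots> = c [^] k \<otimes> (\<phi> ^^ (k * n + q)) u \<otimes> c"
      using u c by (simp only: inner cl m_assoc nat_pow_closed)
    finally show ?case
      using Suc u c by (simp add: m_assoc)
  qed (use u c in simp)
  show ?thesis
  proof (rule groupI)
    show "x \<otimes>\<^bsub>?E\<^esub> y \<in> carrier ?E" if "x \<in> carrier ?E" "y \<in> carrier ?E" for x y
      using that n c by (auto simp: cyclic_extension_def)
    show "\<one>\<^bsub>?E\<^esub> \<in> carrier ?E"
      using n by (simp add: cyclic_extension_def)
    show "\<one>\<^bsub>?E\<^esub> \<otimes>\<^bsub>?E\<^esub> x = x" if "x \<in> carrier ?E" for x
      using that n hom_one[OF pow_hom group_axioms group_axioms]
      by (auto simp: cyclic_extension_def)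
    show "x \<otimes>\<^bsub>?E\<^esub> y \<otimes>\<^bsub>?E\<^esub> z = x \<otimes>\<^bsub>?E\<^esub> (y \<otimes>\<^bsub>?E\<^esub> z)"
      if xyz: "x \<in> carrier ?E" "y \<in> carrier ?E" "z \<in> carrier ?E" for x y z
    proof -
      obtain i u j v l w where eqs: "x = (i, u)" "y = (j, v)" "z = (l, w)"
        by (metis surj_pair)
      have cl': "u \<in> carrier G" "v \<in> carrier G" "w \<in> carrier G"
        using xyz by (auto simp: eqs cyclic_extension_def)
      let ?a = "(i + j) div n" and ?b = "((i + j) mod n + l) div n"
      let ?a' = "(j + l) div n" and ?b' = "(i + (j + l) mod n) div n"
      have ab: "?b + ?a = ?b' + ?a'"
        using div_add_mod_div[of i j n l] div_add_mod_div[of j l n i] by (simp add: ac_simps)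
      have "(\<phi> ^^ ((j + l) mod n)) u \<otimes> c [^] ?a' = c [^] ?a' \<otimes> (\<phi> ^^ (j + l)) u"
        using inner_pow[of u ?a' "(j + l) mod n"] cl' by simp
      note swap = this
      have "c [^] ?b' \<otimes> (\<phi> ^^ ((j + l) mod n)) u \<otimes> (c [^] ?a' \<otimes> (\<phi> ^^ l) v \<otimes> w) =
          c [^] ?b' \<otimes> (c [^] ?a' \<otimes> (\<phi> ^^ (j + l)) u) \<otimes> ((\<phi> ^^ l) v \<otimes> w)"
        unfolding swap[symmetric] using cl' c by (simp add: m_assoc)
      also have "\<dots> = c [^] (?b' + ?a') \<otimes> (\<phi> ^^ (j + l)) u \<otimes> ((\<phi> ^^ l) v \<otimes> w)"
        using cl' c by (simp add: m_assoc flip: nat_pow_mult)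
      also have "\<dots> = c [^] (?b + ?a) \<otimes> (\<phi> ^^ (l + j)) u \<otimes> ((\<phi> ^^ l) v \<otimes> w)"
        by (simp only: ab add.commute[of l j])
      also have "\<dots> = c [^] ?b \<otimes> (\<phi> ^^ l) (c [^] ?a \<otimes> (\<phi> ^^ j) u \<otimes> v) \<otimes> w"
        using cl' c by (simp add: m_assoc funpow_add flip: nat_pow_mult)
      finally show ?thesis
        by (simp add: eqs cyclic_extension_def mod_simps add.assoc)
    qed
    show "\<exists>y\<in>carrier ?E. y \<otimes>\<^bsub>?E\<^esub> x = \<one>\<^bsub>?E\<^esub>" if x: "x \<in> carrier ?E" for x
    proof -
      obtain i u where eq: "x = (i, u)" "i < n" and u: "u \<in> carrier G"
        using x by (auto simp: cyclic_extension_def)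
      show ?thesis
      proof (cases "i = 0")
        case True
        then show ?thesis
          using n u by (intro bexI[of _ "(0, inv u)"]) (auto simp: eq(1) cyclic_extension_def)
      next
        case False
        \<comment> \<open>The left inverse needs a \<open>v\<close> with \<open>c \<otimes> (\<phi> ^^ i) v = inv u\<close>. Since \<open>\<phi> ^^ n\<close> is conjugation
            by \<open>c\<close>, a preimage under \<open>\<phi> ^^ i\<close> is obtained by applying \<open>\<phi>\<close> another \<open>n - i\<close> times.\<close>
        define v where "v = (\<phi> ^^ (n - i)) (inv u \<otimes> inv c)"
        have "c \<otimes> (\<phi> ^^ i) v = c \<otimes> (\<phi> ^^ n) (inv u \<otimes> inv c)"
          using eq(2) by (simp add: v_def flip: funpow_add[THEN fun_cong, unfolded o_def])
        also have "\<dots> = inv u"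
          using u c by (simp only: inner inv_closed m_closed) (simp add: m_assoc)
        finally have "c \<otimes> (\<phi> ^^ i) v = inv u" .
        moreover have "v \<in> carrier G"
          using u c by (simp add: v_def)
        ultimately show ?thesis
          using False u c eq(2) n
          by (intro bexI[of _ "(n - i, v)"]) (auto simp: eq(1) cyclic_extension_def)
      qed
    qed
  qed
qed

lemma finite_group_nat_copy:
  fixes K :: "('k, 'n) monoid_scheme"
  assumes K: "group K" and fin: "finite (carrier K)"
  obtains N :: "nat monoid" and f where "group N" "f \<in> iso K N"
proof -
  interpret K: group K by (rule K)
  obtain f :: "'k \<Rightarrow> nat" where f: "inj_on f (carrier K)"
    using finite_imp_inj_to_nat_seg[OF fin] by auto
  let ?g = "inv_into (carrier K) f"
  define N :: "nat monoid" where
    "N = \<lparr>carrier = f ` carrier K, mult = (\<lambda>a b. f (?g a \<otimes>\<^bsub>K\<^esub> ?g b)), one = f \<one>\<^bsub>K\<^esub>\<rparr>"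
  have iso: "f \<in> iso K N"
    using f by (auto simp: iso_def hom_def bij_betw_def N_def)
  have "N = N\<lparr>one := f \<one>\<^bsub>K\<^esub>\<rparr>"
    by (simp add: N_def)
  then have "group N"
    using K.iso_imp_img_group[OF iso] by simp
  with iso show ?thesis
    using that by blast
qed


section \<open>Extensions whose commutators are wedges\<close>

lemma (in group_wedge) wedge_pow_pow:
  assumes s: "s \<in> carrier G"
  shows "(s [^] (i :: nat)) \<and>\<^sub>G (s [^] (j :: nat)) = \<one>\<^bsub>T\<^esub>"
proof -
  have 1: "(s [^] (i :: nat)) \<and>\<^sub>G s = \<one>\<^bsub>T\<^esub>" for i
  proof (induction i)
    case (Suc i)
    then show ?case
      using s group_hom.hom_one[OF act_group_hom[OF s]] by (simp add: wedge_mult_left_act)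
  qed (use s in simp)
  show ?thesis
  proof (induction j)
    case (Suc j)
    then show ?case
      using s 1 group_hom.hom_one[OF act_group_hom[OF s]] by (simp add: wedge_mult_right_act)
  qed (use s in simp)
qed

text \<open>The intermediate stages in the construction of a Schur cover: \<open>W\<close> contains the exterior square as
  the image of \<open>\<iota>\<close>, maps to \<open>G\<close> by \<open>p\<close>, and \<open>commute\<close> says that commutators in \<open>W\<close> are wedges.
  The last assumption keeps the kernel of \<open>p\<close> as small as the Schur multiplier.\<close>
locale wedge_extension = group_wedge G + W: group W for G (structure) and W (structure) +
  fixes \<iota> p
  assumes iota_hom: "\<iota> \<in> hom (exterior_square G) W"
    and iota_inj: "inj_on \<iota> (carrier (exterior_square G))"
    and p_hom: "p \<in> hom W G"
    and p_iota: "t \<in> carrier (exterior_square G) \<Longrightarrow> p (\<iota> t) = commutator_map G t"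
    and commute: "u \<in> carrier W \<Longrightarrow> v \<in> carrier W \<Longrightarrow>
      u \<otimes>\<^bsub>W\<^esub> v = v \<otimes>\<^bsub>W\<^esub> u \<otimes>\<^bsub>W\<^esub> \<iota> (wedge G (p u) (p v))"
    and kernel_p: "kernel W G p \<subseteq> \<iota> ` kernel (exterior_square G) G (commutator_map G)"

sublocale wedge_extension \<subseteq> \<iota>: group_hom "exterior_square G" W \<iota>
  by (simp add: group_hom_def group_hom_axioms_def iota_hom T.group_axioms W.group_axioms)

sublocale wedge_extension \<subseteq> p: group_hom W G p
  by (simp add: group_hom_def group_hom_axioms_def p_hom group_axioms W.group_axioms)

context wedge_extension
begin

text \<open>Conjugation in \<open>W\<close> restricts to the action of \<open>G\<close> on the exterior square.\<close>
lemma iota_commute: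
  assumes t: "t \<in> carrier T" and v: "v \<in> carrier W"
  shows "\<iota> t \<otimes>\<^bsub>W\<^esub> v = v \<otimes>\<^bsub>W\<^esub> \<iota> (act (p v) t)"
  using commute[of "\<iota> t" v] t v
  by (simp add: p_iota act_eq_mult_wedge W.m_assoc)

text \<open>By \<open>commute\<close>, this is what conjugation by a lift of \<open>x\<close> does to \<open>u\<close>. The formula makes sense
  whether or not \<open>x\<close> has a lift in \<open>W\<close>.\<close>
definition shift where "shift x u = u \<otimes>\<^bsub>W\<^esub> \<iota> (p u \<and>\<^sub>G x)"

lemma shift_closed [simp, intro]: "x \<in> carrier G \<Longrightarrow> u \<in> carrier W \<Longrightarrow> shift x u \<in> carrier W"
  by (simp add: shift_def)

lemma shift_mult:
  assumes x: "x \<in> carrier G" and u: "u \<in> carrier W" and v: "v \<in> carrier W"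
  shows "shift x (u \<otimes>\<^bsub>W\<^esub> v) = shift x u \<otimes>\<^bsub>W\<^esub> shift x v"
proof -
  have "shift x (u \<otimes>\<^bsub>W\<^esub> v) = u \<otimes>\<^bsub>W\<^esub> (v \<otimes>\<^bsub>W\<^esub> \<iota> (act (p v) (p u \<and>\<^sub>G x))) \<otimes>\<^bsub>W\<^esub> \<iota> (p v \<and>\<^sub>G x)"
    using x u v by (simp add: shift_def wedge_mult_left_act W.m_assoc)
  also have "v \<otimes>\<^bsub>W\<^esub> \<iota> (act (p v) (p u \<and>\<^sub>G x)) = \<iota> (p u \<and>\<^sub>G x) \<otimes>\<^bsub>W\<^esub> v"
    using x u v by (simp add: iota_commute)
  finally show ?thesis
    using x u v by (simp add: shift_def W.m_assoc)
qed

lemma shift_iota: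
  assumes "x \<in> carrier G" "t \<in> carrier T"
  shows "shift x (\<iota> t) = \<iota> (act x t)"
  using assms by (simp add: shift_def p_iota act_eq_mult_wedge)

lemma shift_shift:
  assumes x: "x \<in> carrier G" and y: "y \<in> carrier G" and u: "u \<in> carrier W"
  shows "shift x (shift y u) = shift (y \<otimes> x) u"
proof -
  have "shift x (shift y u) = shift x u \<otimes>\<^bsub>W\<^esub> shift x (\<iota> (p u \<and>\<^sub>G y))"
    using x y u by (subst (2) shift_def) (simp add: shift_mult)
  also have "\<dots> = shift (y \<otimes> x) u"
    using x y u by (simp only: shift_iota wedge_closed p.hom_closed)
      (simp add: shift_def wedge_mult_right_act W.m_assoc)
  finally show ?thesis .
qed

lemma shift_pow:
  assumes x: "x \<in> carrier G" and u: "u \<in> carrier W"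
  shows "(shift x ^^ j) u = shift (x [^] j) u"
proof (induction j)
  case 0
  then show ?case using x u by (simp add: shift_def)
next
  case (Suc j)
  then show ?case using x u by (simp add: shift_shift)
qed

text \<open>The cyclic extension is formed with the least \<open>n\<close> for which \<open>s\<close> to the power \<open>n\<close> has a lift \<open>c\<close>;
  the lift is fixed by the shift since powers of \<open>s\<close> have trivial wedges. Minimality of \<open>n\<close> is what
  keeps the kernel from growing: if \<open>(i, u)\<close> maps to \<open>\<one>\<close>, then \<open>s\<close> to the power \<open>i\<close> already lies in the
  image, so \<open>i = 0\<close>.\<close>
lemma wedge_extension_step:
  assumes fin: "finite (carrier G)" and finW: "finite (carrier W)"
    and s: "s \<in> carrier G" and sP: "s \<notin> p ` carrier W"
  obtains E :: "(nat \<times> 'c) monoid" and \<iota>' p' where "wedge_extension G E \<iota>' p'" "finite (carrier E)"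
    "card (p ` carrier W) < card (p' ` carrier E)"
proof -
  let ?P = "p ` carrier W"
  have P: "subgroup ?P G"
    by (rule p.img_is_subgroup)
  define n where "n = (LEAST k :: nat. 0 < k \<and> s [^] k \<in> ?P)"
  have "0 < order G \<and> s [^] order G \<in> ?P"
    using fin s subgroup.one_closed[OF P] pow_order_eq_1 order_gt_0_iff_finite by metis
  then have n: "0 < n" "s [^] n \<in> ?P"
    unfolding n_def by (metis (mono_tags, lifting) LeastI)+
  have minimal: "i = 0" if "i < n" "s [^] i \<in> ?P" for i :: nat
    using not_less_Least[of i "\<lambda>k. 0 < k \<and> s [^] k \<in> ?P"] that unfolding n_def by auto
  have n1: "1 < n"
  proof (rule ccontr)
    assume "\<not> 1 < n"
    with n have "n = 1" by simp
    with n sP s show False by simp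
  qed
  obtain c where c: "c \<in> carrier W" "p c = s [^] n"
    using n(2) by auto
  define E where "E = cyclic_extension W (shift s) n c"
  define \<iota>' where "\<iota>' t = (0 :: nat, \<iota> t)" for t
  define p' where "p' = (\<lambda>(i :: nat, u). s [^] i \<otimes> p u)"
  have carrE: "carrier E = {..<n} \<times> carrier W"
    by (simp add: E_def cyclic_extension_def)
  have multE: "(i, u) \<otimes>\<^bsub>E\<^esub> (j, v) =
      ((i + j) mod n, c [^]\<^bsub>W\<^esub> ((i + j) div n) \<otimes>\<^bsub>W\<^esub> (shift (s [^] j) u \<otimes>\<^bsub>W\<^esub> v))"
    if "u \<in> carrier W" "v \<in> carrier W" for i u j v
    using that s c by (simp add: E_def cyclic_extension_def shift_pow W.m_assoc)
  have multE': "x \<otimes>\<^bsub>E\<^esub> \<iota>' t = (fst x, snd x \<otimes>\<^bsub>W\<^esub> \<iota> t)" if "x \<in> carrier E" "t \<in> carrier T" for x t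
    using that by (cases x) (auto simp: \<iota>'_def multE carrE shift_def)
  have grpE: "group E"
    unfolding E_def
  proof (rule W.group_cyclic_extension)
    show "shift s \<in> hom W W"
      using s by (intro homI) (simp_all add: shift_mult)
    show "shift s c = c"
      using s c wedge_pow_pow[OF s, of n 1] by (simp add: shift_def)
    show "c \<otimes>\<^bsub>W\<^esub> (shift s ^^ n) u = u \<otimes>\<^bsub>W\<^esub> c" if "u \<in> carrier W" for u
      using that s c commute[of u c] by (simp add: shift_pow) (simp add: shift_def W.m_assoc)
  qed (use n c in auto)
  have "wedge_extension G E \<iota>' p'"
  proof (intro wedge_extension.intro group_wedge_axioms grpE wedge_extension_axioms.intro)
    show "\<iota>' \<in> hom T E"
      using n by (intro homI) (auto simp: \<iota>'_def carrE multE shift_def)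
    show "inj_on \<iota>' (carrier T)"
      using iota_inj by (auto simp: inj_on_def \<iota>'_def)
    show "p' (\<iota>' t) = d t" if "t \<in> carrier T" for t
      using that by (simp add: p'_def \<iota>'_def p_iota)
    show "p' \<in> hom E G"
    proof (rule homI)
      show "p' x \<in> carrier G" if "x \<in> carrier E" for x
        using that s by (auto simp: carrE p'_def)
      fix x y assume "x \<in> carrier E" "y \<in> carrier E"
      then obtain i u j v where xy: "x = (i, u)" "y = (j, v)" "u \<in> carrier W" "v \<in> carrier W"
        by (auto simp: carrE)
      have "p' (x \<otimes>\<^bsub>E\<^esub> y) = s [^] ((i + j) mod n) \<otimes> (s [^] n) [^] ((i + j) div n) \<otimes>
          (p u \<otimes> cm (p u) (s [^] j)) \<otimes> p v"
        using xy s c by (simp add: p'_def multE shift_def p_iota p.hom_nat_pow m_assoc)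
      also have "s [^] ((i + j) mod n) \<otimes> (s [^] n) [^] ((i + j) div n) = s [^] i \<otimes> s [^] j"
        using s by (simp add: nat_pow_pow nat_pow_mult)
      also have "s [^] i \<otimes> s [^] j \<otimes> (p u \<otimes> cm (p u) (s [^] j)) \<otimes> p v = p' x \<otimes> p' y"
        using xy s by (simp add: p'_def group_word_simps)
      finally show "p' (x \<otimes>\<^bsub>E\<^esub> y) = p' x \<otimes> p' y" .
    qed
    show "x \<otimes>\<^bsub>E\<^esub> y = y \<otimes>\<^bsub>E\<^esub> x \<otimes>\<^bsub>E\<^esub> \<iota>' (p' x \<and>\<^sub>G p' y)" if xE: "x \<in> carrier E" and yE: "y \<in> carrier E" for x y
    proof -
      obtain i u j v where xy: "x = (i, u)" "y = (j, v)" "u \<in> carrier W" "v \<in> carrier W"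
        using xE yE by (auto simp: carrE)
      let ?a = "s [^] i" and ?b = "s [^] j"
      let ?x = "p u" and ?y = "p v"
      have G: "?a \<in> carrier G" "?b \<in> carrier G" "?x \<in> carrier G" "?y \<in> carrier G"
        using xy s by auto
      \<comment> \<open>Of the four factors in \<open>wedge_mult_mult\<close>, the wedge of the two powers of \<open>s\<close> is trivial.
          The other three are absorbed one after the other.\<close>
      have "p' x \<and>\<^sub>G p' y = act ?x (?a \<and>\<^sub>G ?y) \<otimes>\<^bsub>T\<^esub> (?x \<and>\<^sub>G ?y) \<otimes>\<^bsub>T\<^esub> act ?y (?x \<and>\<^sub>G ?b)"
        using G s group_hom.hom_one[OF act_group_hom] by (simp add: p'_def xy wedge_mult_mult wedge_pow_pow)
      then have "shift ?a v \<otimes>\<^bsub>W\<^esub> u \<otimes>\<^bsub>W\<^esub> \<iota> (p' x \<and>\<^sub>G p' y) =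
          v \<otimes>\<^bsub>W\<^esub> \<iota> (?y \<and>\<^sub>G ?a) \<otimes>\<^bsub>W\<^esub> (u \<otimes>\<^bsub>W\<^esub> \<iota> (act ?x (?a \<and>\<^sub>G ?y))) \<otimes>\<^bsub>W\<^esub>
            \<iota> (?x \<and>\<^sub>G ?y) \<otimes>\<^bsub>W\<^esub> \<iota> (act ?y (?x \<and>\<^sub>G ?b))"
        using G xy by (simp add: shift_def W.m_assoc)
      also have "u \<otimes>\<^bsub>W\<^esub> \<iota> (act ?x (?a \<and>\<^sub>G ?y)) = \<iota> (?a \<and>\<^sub>G ?y) \<otimes>\<^bsub>W\<^esub> u"
        using G xy by (simp add: iota_commute)
      also have "v \<otimes>\<^bsub>W\<^esub> \<iota> (?y \<and>\<^sub>G ?a) \<otimes>\<^bsub>W\<^esub> (\<iota> (?a \<and>\<^sub>G ?y) \<otimes>\<^bsub>W\<^esub> u) =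
          v \<otimes>\<^bsub>W\<^esub> \<iota> ((?y \<and>\<^sub>G ?a) \<otimes>\<^bsub>T\<^esub> (?a \<and>\<^sub>G ?y)) \<otimes>\<^bsub>W\<^esub> u"
        using G xy by (simp add: W.m_assoc)
      also have "\<dots> = v \<otimes>\<^bsub>W\<^esub> u"
        using G xy by (simp add: wedge_swap)
      also have "v \<otimes>\<^bsub>W\<^esub> u \<otimes>\<^bsub>W\<^esub> \<iota> (?x \<and>\<^sub>G ?y) = u \<otimes>\<^bsub>W\<^esub> v"
        using xy by (simp add: commute[of u v])
      also have "u \<otimes>\<^bsub>W\<^esub> v \<otimes>\<^bsub>W\<^esub> \<iota> (act ?y (?x \<and>\<^sub>G ?b)) = shift ?b u \<otimes>\<^bsub>W\<^esub> v"
        using G xy by (simp add: shift_def W.m_assoc iota_commute)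
      finally have "shift ?b u \<otimes>\<^bsub>W\<^esub> v = shift ?a v \<otimes>\<^bsub>W\<^esub> u \<otimes>\<^bsub>W\<^esub> \<iota> (p' x \<and>\<^sub>G p' y)" ..
      moreover have "p' x \<and>\<^sub>G p' y \<in> carrier T"
        using G by (simp add: p'_def xy)
      moreover have "y \<otimes>\<^bsub>E\<^esub> x \<in> carrier E"
        using xE yE group.subgroup_self[OF grpE] by (simp add: subgroup.m_closed)
      ultimately show ?thesis
        using xy G c by (simp add: multE') (simp add: multE add.commute W.m_assoc)
    qed
    show "kernel E G p' \<subseteq> \<iota>' ` kernel T G d"
    proof
      fix x assume "x \<in> kernel E G p'"
      then obtain i u where x: "x = (i, u)" "i < n" "u \<in> carrier W" "s [^] i \<otimes> p u = \<one>"
        by (auto simp: kernel_def carrE p'_def)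
      then have "s [^] i = p (inv\<^bsub>W\<^esub> u)"
        using s by (simp add: inv_equality[symmetric] inv_unique')
      then have i: "i = 0"
        using minimal[OF x(2)] x(3) subgroup.m_inv_closed[OF P] by simp
      with x have "u \<in> kernel W G p"
        by (simp add: kernel_def)
      with kernel_p obtain t where "t \<in> kernel T G d" "u = \<iota> t"
        by blast
      with i x show "x \<in> \<iota>' ` kernel T G d"
        by (auto simp: \<iota>'_def)
    qed
  qed
  moreover have "finite (carrier E)"
    using finW by (simp add: carrE)
  moreover have "card ?P < card (p' ` carrier E)"
  proof (rule psubset_card_mono)
    show "finite (p' ` carrier E)"
      using calculation(2) by simp
    have "p u = p' (0, u)" if "u \<in> carrier W" for u
      using that by (simp add: p'_def)
    then have "?P \<subseteq> p' ` carrier E"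
      using n by (force simp: carrE)
    moreover have "s = p' (1, \<one>\<^bsub>W\<^esub>)"
      using s by (simp add: p'_def)
    then have "s \<in> p' ` carrier E"
      using n1 by (auto simp: carrE)
    ultimately show "?P \<subset> p' ` carrier E"
      using sP by blast
  qed
  ultimately show ?thesis
    using that by blast
qed

text \<open>Adjoining an element changes the type of the group. Returning to the natural numbers after each
  step allows the steps to be iterated.\<close>
lemma wedge_extension_nat_copy:
  assumes finW: "finite (carrier W)"
  obtains N :: "nat monoid" and \<iota>' p' where "wedge_extension G N \<iota>' p'" "finite (carrier N)"
    "p' ` carrier N = p ` carrier W"
proof -
  obtain N :: "nat monoid" and f where N: "group N" and f: "f \<in> iso W N"
    using finite_group_nat_copy[OF W.group_axioms finW] by blast
  interpret N: group N by (rule N)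
  define g where "g = inv_into (carrier W) f"
  have bij: "bij_betw f (carrier W) (carrier N)" and hom: "f \<in> hom W N"
    using f by (auto simp: iso_def)
  have g: "g \<in> iso N W"
    unfolding g_def using W.iso_set_sym[OF f] by (simp add: inv_into_def)
  have gf [simp]: "g (f u) = u" if "u \<in> carrier W" for u
    using that bij by (simp add: g_def bij_betw_inv_into_left)
  have fg [simp]: "f (g x) = x" if "x \<in> carrier N" for x
    using that bij by (simp add: g_def bij_betw_inv_into_right)
  have ghom: "g \<in> hom N W" and gbij: "bij_betw g (carrier N) (carrier W)"
    using g by (auto simp: iso_def)
  have gcl [simp]: "g x \<in> carrier W" if "x \<in> carrier N" for x
    using that ghom by (auto simp: hom_def)
  have "wedge_extension G N (\<lambda>t. f (\<iota> t)) (\<lambda>x. p (g x))"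
  proof (intro wedge_extension.intro group_wedge_axioms N wedge_extension_axioms.intro)
    show "(\<lambda>t. f (\<iota> t)) \<in> hom T N"
      using hom by (intro homI) (auto simp: hom_def)
    show "inj_on (\<lambda>t. f (\<iota> t)) (carrier T)"
    proof (rule inj_onI)
      fix t u assume t: "t \<in> carrier T" and u: "u \<in> carrier T" and "f (\<iota> t) = f (\<iota> u)"
      then have "\<iota> t = \<iota> u"
        by (intro inj_onD[OF bij_betw_imp_inj_on[OF bij]]) simp_all
      with t u show "t = u"
        using iota_inj by (simp add: inj_on_eq_iff)
    qed
    show "(\<lambda>x. p (g x)) \<in> hom N G"
      using ghom by (intro homI) (auto simp: hom_def)
    show "p (g (f (\<iota> t))) = d t" if "t \<in> carrier T" for t
      using that by (simp add: p_iota)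
    fix x y assume x: "x \<in> carrier N" and y: "y \<in> carrier N"
    have "f (g x \<otimes>\<^bsub>W\<^esub> g y) = f (g y \<otimes>\<^bsub>W\<^esub> g x \<otimes>\<^bsub>W\<^esub> \<iota> (p (g x) \<and>\<^sub>G p (g y)))"
      using x y commute[of "g x" "g y"] by simp
    with hom x y show "x \<otimes>\<^bsub>N\<^esub> y = y \<otimes>\<^bsub>N\<^esub> x \<otimes>\<^bsub>N\<^esub> f (\<iota> (p (g x) \<and>\<^sub>G p (g y)))"
      by (simp add: hom_mult)
  next
    show "kernel N G (\<lambda>x. p (g x)) \<subseteq> (\<lambda>t. f (\<iota> t)) ` kernel T G d"
    proof
      fix x assume x: "x \<in> kernel N G (\<lambda>x. p (g x))"
      then have "g x \<in> kernel W G p"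
        by (simp add: kernel_def)
      with kernel_p obtain t where "t \<in> kernel T G d" "g x = \<iota> t"
        by blast
      with x show "x \<in> (\<lambda>t. f (\<iota> t)) ` kernel T G d"
        by (metis (mono_tags, lifting) fg image_eqI kernel_def mem_Collect_eq)
    qed
  qed
  moreover have "finite (carrier N)"
    using bij finW by (simp add: bij_betw_finite)
  moreover have "(\<lambda>x. p (g x)) ` carrier N = p ` carrier W"
    using gbij by (simp add: bij_betw_def image_image[symmetric])
  ultimately show ?thesis
    using that by blast
qed

end

context group_wedge
begin

lemma wedge_extension_exterior_square: "wedge_extension G T (\<lambda>t. t) d"
proof (intro wedge_extension.intro group_wedge_axioms T.group_axioms wedge_extension_axioms.intro)
  show "t \<otimes>\<^bsub>T\<^esub> u = u \<otimes>\<^bsub>T\<^esub> t \<otimes>\<^bsub>T\<^esub> (d t \<and>\<^sub>G d u)" if "t \<in> carrier T" "u \<in> carrier T" for t u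
    using that by (simp add: peiffer[of u t] act_eq_mult_wedge T.m_assoc)
qed (auto simp: commutator_map_hom intro: homI)

text \<open>A wedge extension with an image of largest possible size is onto, by \<open>wedge_extension_step\<close>.\<close>
lemma wedge_extension_onto_exists:
  assumes fin: "finite (carrier G)"
  obtains W :: "nat monoid" and \<iota> p where "wedge_extension G W \<iota> p" "finite (carrier W)"
    "p ` carrier W = carrier G"
proof -
  define Q where "Q k \<longleftrightarrow> (\<exists>(W :: nat monoid) \<iota> p. wedge_extension G W \<iota> p \<and> finite (carrier W) \<and>
    card (p ` carrier W) = k)" for k
  have bound: "k \<le> order G" if Qk: "Q k" for k
  proof -
    obtain W :: "nat monoid" and \<iota> p where W: "wedge_extension G W \<iota> p" "card (p ` carrier W) = k"
      using Qk by (auto simp: Q_def)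
    interpret W: wedge_extension G W \<iota> p by (rule W(1))
    have "p ` carrier W \<subseteq> carrier G" by auto
    then show ?thesis
      using W(2) fin by (metis card_mono order_def)
  qed
  have "\<exists>k. Q k"
    using wedge_extension.wedge_extension_nat_copy[OF wedge_extension_exterior_square finite_exterior_square[OF fin]]
    unfolding Q_def by metis
  then obtain k where k: "Q k" "\<And>l. Q l \<Longrightarrow> l \<le> k"
    using GreatestI_ex_nat[of Q] Greatest_le_nat[of Q] bound by blast
  obtain W :: "nat monoid" and \<iota> p where W: "wedge_extension G W \<iota> p" "finite (carrier W)"
      "card (p ` carrier W) = k"
    using k(1) by (auto simp: Q_def)
  interpret W: wedge_extension G W \<iota> p by (rule W(1))
  have "carrier G \<subseteq> p ` carrier W"
  proof
    fix s assume s: "s \<in> carrier G"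
    show "s \<in> p ` carrier W"
    proof (rule ccontr)
      assume "s \<notin> p ` carrier W"
      with s obtain E :: "(nat \<times> nat) monoid" and \<iota>' p' where E: "wedge_extension G E \<iota>' p'"
          "finite (carrier E)" "k < card (p' ` carrier E)"
        using W.wedge_extension_step[OF fin W(2)] W(3) by metis
      obtain N :: "nat monoid" and \<iota>'' p'' where "wedge_extension G N \<iota>'' p''" "finite (carrier N)"
          "p'' ` carrier N = p' ` carrier E"
        using wedge_extension.wedge_extension_nat_copy[OF E(1,2)] by metis
      then have "Q (card (p' ` carrier E))"
        unfolding Q_def by metis
      with k(2) E(3) show False by fastforce
    qed
  qed
  then have "p ` carrier W = carrier G" by auto
  with W that show ?thesis by blast
qed

end


section \<open>Commutators in stem extensions\<close>

context group
begin

lemma commutator_eq_one_iff: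
  assumes "x \<in> carrier G" "y \<in> carrier G"
  shows "commutator G x y = \<one> \<longleftrightarrow> x \<otimes> y = y \<otimes> x"
proof -
  have "commutator G x y = inv (y \<otimes> x) \<otimes> (x \<otimes> y)"
    using assms by (simp add: group_word_simps)
  then show ?thesis
    using assms by (simp add: inv_solve_left')
qed

lemma inv_commutator:
  "x \<in> carrier G \<Longrightarrow> y \<in> carrier G \<Longrightarrow> inv (commutator G x y) = commutator G y x"
  by (simp add: group_word_simps)

lemma commutator_mult_center:
  assumes x: "x \<in> carrier G" and y: "y \<in> carrier G" and z: "z \<in> group_center G"
  shows "commutator G (x \<otimes> z) y = commutator G x y"
proof -
  have zG: "z \<in> carrier G"
    using z by (simp add: group_center_def)
  have swap: "z \<otimes> g = g \<otimes> z" if "g \<in> carrier G" for g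
    using z that by (simp add: group_center_def)
  have "commutator G (x \<otimes> z) y = inv z \<otimes> (inv x \<otimes> (inv y \<otimes> (x \<otimes> (z \<otimes> y))))"
    using x y zG by (simp add: group_word_simps)
  also have "\<dots> = inv z \<otimes> (commutator G x y \<otimes> z)"
    using x y zG by (simp only: swap[OF y]) (simp add: group_word_simps)
  also have "commutator G x y \<otimes> z = z \<otimes> commutator G x y"
    using x y by (intro swap[symmetric]) simp
  also have "inv z \<otimes> (z \<otimes> commutator G x y) = commutator G x y"
    using x y zG by (simp add: cancel_left)
  finally show ?thesis .
qed

lemma commutator_in_derived:
  assumes "x \<in> carrier G" "y \<in> carrier G"
  shows "commutator G x y \<in> derived G (carrier G)"
proof -
  have "commutator G x y = inv x \<otimes> inv y \<otimes> inv (inv x) \<otimes> inv (inv y)"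
    using assms by (simp add: commutator_def)
  then show ?thesis
    unfolding derived_def using assms by (intro generate.incl) blast
qed

lemma derived_subset_if_commutators:
  assumes K: "subgroup K G"
    and comm: "\<And>x y. x \<in> carrier G \<Longrightarrow> y \<in> carrier G \<Longrightarrow> commutator G x y \<in> K"
  shows "derived G (carrier G) \<subseteq> K"
  unfolding derived_def
proof (rule generate_subgroup_incl[OF _ K], safe)
  fix x y assume xy: "x \<in> carrier G" "y \<in> carrier G"
  then have "x \<otimes> y \<otimes> inv x \<otimes> inv y = commutator G (inv x) (inv y)"
    by (simp add: commutator_def)
  then show "x \<otimes> y \<otimes> inv x \<otimes> inv y \<in> K"
    using xy comm by simp
qed

end

lemma (in group_hom) order_eq_kernel_image:
  assumes "finite (carrier G)"
  shows "order G = card (kernel G H h) * card (h ` carrier G)"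
proof -
  have sub: "subgroup (kernel G H h) G"
    by (rule subgroup_kernel)
  let ?I = "H\<lparr>carrier := h ` carrier G\<rparr>"
  interpret I: group_hom G ?I h
  proof (intro group_hom.intro group_hom_axioms.intro)
    show "group ?I"
      by (rule subgroup.subgroup_is_group[OF img_is_subgroup H.group_axioms])
    show "h \<in> hom G ?I"
      by (intro homI) auto
  qed (rule G.group_axioms)
  have "kernel G ?I h = kernel G H h"
    by (simp add: kernel_def)
  moreover have "(\<lambda>X. the_elem (h ` X)) \<in> iso (G Mod kernel G ?I h) ?I"
    by (rule I.FactGroup_iso_set) simp
  ultimately have "card (rcosets\<^bsub>G\<^esub> kernel G H h) = card (h ` carrier G)"
    by (auto simp: iso_def FactGroup_def dest: bij_betw_same_card)
  then show ?thesis
    using G.lagrange[OF sub] by (simp add: mult.commute)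
qed

context wedge_extension
begin

lemma kernel_p_eq: "kernel W G p = \<iota> ` kernel T G d"
proof (rule equalityI[OF kernel_p])
  show "\<iota> ` kernel T G d \<subseteq> kernel W G p"
    by (auto simp: kernel_def p_iota)
qed

lemma card_kernel_p: "card (kernel W G p) = order (schur_multiplier G)"
proof -
  have "inj_on \<iota> (kernel T G d)"
    using iota_inj by (rule inj_on_subset) (auto simp: kernel_def)
  then show ?thesis
    by (simp add: kernel_p_eq card_image order_def schur_multiplier_def)
qed

text \<open>The kernel of \<open>p\<close> is central since a wedge with \<open>\<one>\<close> is trivial. When \<open>p\<close> is onto, every wedge is
  a commutator in \<open>W\<close>, so the whole image of \<open>\<iota>\<close>, which contains the kernel, lies in the derived
  subgroup.\<close>
lemma wedge_extension_onto_imp_stem: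
  assumes fin: "finite (carrier W)" and onto: "p ` carrier W = carrier G"
  shows "stem_extension G W p"
proof -
  have "u \<in> group_center W" if u: "u \<in> kernel W G p" for u
  proof -
    have "u \<otimes>\<^bsub>W\<^esub> v = v \<otimes>\<^bsub>W\<^esub> u" if "v \<in> carrier W" for v
      using commute[of u v] u that by (simp add: kernel_def)
    with u show ?thesis
      by (simp add: group_center_def kernel_def)
  qed
  moreover have "u \<in> derived W (carrier W)" if u: "u \<in> kernel W G p" for u
  proof -
    have sub: "subgroup (derived W (carrier W)) W"
      by (rule W.derived_is_subgroup) simp
    have wedge_in: "\<iota> (x \<and>\<^sub>G y) \<in> derived W (carrier W)" if x: "x \<in> carrier G" and y: "y \<in> carrier G" for x y
    proof -
      obtain a b where ab: "a \<in> carrier W" "b \<in> carrier W" "p a = x" "p b = y"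
        using x y onto by (metis imageE)
      have "commutator W a b = inv\<^bsub>W\<^esub> (b \<otimes>\<^bsub>W\<^esub> a) \<otimes>\<^bsub>W\<^esub> (a \<otimes>\<^bsub>W\<^esub> b)"
        using ab by (simp add: commutator_def W.m_assoc W.inv_mult_group)
      also have "\<dots> = \<iota> (x \<and>\<^sub>G y)"
        using ab x y by (simp add: commute[of a b] W.cancel_left)
      finally show ?thesis
        using W.commutator_in_derived[OF ab(1,2)] by simp
    qed
    have "\<iota> t \<in> derived W (carrier W)" if "t \<in> carrier T" for t
      using that
    proof (induction rule: exterior_square_induct)
      case one
      then show ?case using subgroup.one_closed[OF sub] by simp
    next
      case (wedge x y)
      then show ?case by (rule wedge_in)
    next
      case (inv x y)
      then show ?case using subgroup.m_inv_closed[OF sub wedge_in] by simp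
    next
      case (mult t u)
      then show ?case using subgroup.m_closed[OF sub] by simp
    qed
    moreover obtain t where "t \<in> kernel T G d" "u = \<iota> t"
      using u kernel_p by blast
    ultimately show ?thesis
      by (simp add: kernel_def)
  qed
  ultimately show ?thesis
    using fin onto p_hom W.group_axioms by (auto simp: stem_extension_def central_extension_def)
qed

end

context group_wedge
begin

text \<open>Since the kernel is central, the commutator of lifts is a well-defined function on \<open>G\<close>. It
  satisfies the relations of the exterior square because commutators in \<open>H\<close> do.\<close>
lemma central_extension_wedge_hom:
  assumes H: "central_extension G H \<pi>"
  obtains \<psi> where "\<psi> \<in> hom T H"
    and "\<And>a b. a \<in> carrier H \<Longrightarrow> b \<in> carrier H \<Longrightarrow> \<psi> (\<pi> a \<and>\<^sub>G \<pi> b) = commutator H a b"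
proof -
  interpret H: group H
    using H by (simp add: central_extension_def)
  have cen: "kernel H G \<pi> \<subseteq> group_center H" and onto: "\<pi> ` carrier H = carrier G"
    using H by (auto simp: central_extension_def)
  interpret \<pi>: group_hom H G \<pi>
    using H by (simp add: central_extension_def group_hom_def group_hom_axioms_def group_axioms)
  have \<pi>_conj: "\<pi> (conjugate H a b) = cj (\<pi> a) (\<pi> b)" if "a \<in> carrier H" "b \<in> carrier H" for a b
    using that by (simp add: conjugate_def)
  have left: "commutator H a b = commutator H a' b"
    if "a \<in> carrier H" "a' \<in> carrier H" "b \<in> carrier H" "\<pi> a = \<pi> a'" for a a' b
  proof -
    have "inv\<^bsub>H\<^esub> a \<otimes>\<^bsub>H\<^esub> a' \<in> kernel H G \<pi>"
      using that by (simp add: kernel_def)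
    then show ?thesis
      using H.commutator_mult_center[of a b "inv\<^bsub>H\<^esub> a \<otimes>\<^bsub>H\<^esub> a'"] that cen
      by (simp add: H.cancel_left subset_iff)
  qed
  have right: "commutator H b a = commutator H b a'"
    if "a \<in> carrier H" "a' \<in> carrier H" "b \<in> carrier H" "\<pi> a = \<pi> a'" for a a' b
    using left[OF that] that by (metis H.inv_commutator)
  define \<sigma> where "\<sigma> = inv_into (carrier H) \<pi>"
  have \<sigma> [simp]: "\<sigma> x \<in> carrier H" "\<pi> (\<sigma> x) = x" if "x \<in> carrier G" for x
    using that onto by (simp_all add: \<sigma>_def inv_into_into f_inv_into_f)
  define f where "f x y = commutator H (\<sigma> x) (\<sigma> y)" for x y
  have f: "f (\<pi> a) (\<pi> b) = commutator H a b" if a: "a \<in> carrier H" and b: "b \<in> carrier H" for a b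
    unfolding f_def using left[of "\<sigma> (\<pi> a)" a "\<sigma> (\<pi> b)"] right[of "\<sigma> (\<pi> b)" b a] a b by simp
  have lift: "\<exists>a\<in>carrier H. x = \<pi> a" if "x \<in> carrier G" for x
    using that onto by blast
  obtain \<psi> where "\<psi> \<in> hom T H"
    and "\<And>x y. x \<in> carrier G \<Longrightarrow> y \<in> carrier G \<Longrightarrow> \<psi> (x \<and>\<^sub>G y) = f x y"
  proof (rule exterior_square_lift[OF H.group_axioms, of f])
    show "f x y \<in> carrier H" if "x \<in> carrier G" "y \<in> carrier G" for x y
      using that by (simp add: f_def)
    show "f x x = \<one>\<^bsub>H\<^esub>" if "x \<in> carrier G" for x
      using that by (simp add: f_def H.commutator_eq_one_iff)
    fix x y z assume "x \<in> carrier G" "y \<in> carrier G" "z \<in> carrier G"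
    then obtain a b c where abc: "a \<in> carrier H" "b \<in> carrier H" "c \<in> carrier H"
        "x = \<pi> a" "y = \<pi> b" "z = \<pi> c"
      using lift by metis
    then show "f (x \<otimes> y) z = f (cj x y) (cj z y) \<otimes>\<^bsub>H\<^esub> f y z"
      by (simp add: f flip: \<pi>_conj \<pi>.hom_mult) (simp add: H.group_word_simps)
    show "f x (y \<otimes> z) = f x z \<otimes>\<^bsub>H\<^esub> f (cj x z) (cj y z)"
      using abc by (simp add: f flip: \<pi>_conj \<pi>.hom_mult) (simp add: H.group_word_simps)
  qed blast
  with f show ?thesis
    using that[of \<psi>] by simp
qed

text \<open>The image of \<open>\<psi>\<close> contains all commutators of \<open>H\<close>, hence the derived subgroup, and with it the
  kernel of \<open>\<pi>\<close>. An element that \<open>\<psi>\<close> sends to that kernel belongs to the Schur multiplier, as \<open>\<pi>\<close>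
  composed with \<open>\<psi>\<close> is the commutator map.\<close>
lemma stem_extension_wedge_hom:
  assumes H: "stem_extension G H \<pi>"
  obtains \<psi> where "\<psi> \<in> hom T H"
    and "\<And>a b. a \<in> carrier H \<Longrightarrow> b \<in> carrier H \<Longrightarrow> \<psi> (\<pi> a \<and>\<^sub>G \<pi> b) = commutator H a b"
    and "kernel H G \<pi> \<subseteq> \<psi> ` kernel T G d"
proof -
  have ce: "central_extension G H \<pi>" and der: "kernel H G \<pi> \<subseteq> derived H (carrier H)"
    using H by (auto simp: stem_extension_def)
  obtain \<psi> where \<psi>: "\<psi> \<in> hom T H"
    and \<psi>_wedge: "\<And>a b. a \<in> carrier H \<Longrightarrow> b \<in> carrier H \<Longrightarrow> \<psi> (\<pi> a \<and>\<^sub>G \<pi> b) = commutator H a b"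
    by (rule central_extension_wedge_hom[OF ce]) (rule that)
  interpret H: group H
    using ce by (simp add: central_extension_def)
  have onto: "\<pi> ` carrier H = carrier G"
    using ce by (auto simp: central_extension_def)
  interpret \<pi>: group_hom H G \<pi>
    using ce by (simp add: central_extension_def group_hom_def group_hom_axioms_def group_axioms)
  interpret \<psi>: group_hom T H \<psi>
    using \<psi> by (simp add: group_hom_def group_hom_axioms_def T.group_axioms H.group_axioms)
  have \<pi>\<psi>: "\<pi> (\<psi> t) = d t" if t: "t \<in> carrier T" for t
  proof (rule exterior_square_hom_eqI[OF group_axioms _ commutator_map_hom _ t])
    show "(\<lambda>t. \<pi> (\<psi> t)) \<in> hom T G"
      by (intro homI) simp_all
    fix x y assume "x \<in> carrier G" "y \<in> carrier G"
    then obtain a b where ab: "a \<in> carrier H" "b \<in> carrier H" "\<pi> a = x" "\<pi> b = y"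
      using onto by (metis imageE)
    have "\<pi> (\<psi> (\<pi> a \<and>\<^sub>G \<pi> b)) = cm (\<pi> a) (\<pi> b)"
      using \<psi>_wedge[OF ab(1,2)] ab(1,2) by (simp add: commutator_def)
    with ab show "\<pi> (\<psi> (x \<and>\<^sub>G y)) = d (x \<and>\<^sub>G y)"
      by auto
  qed
  have "commutator H a b \<in> \<psi> ` carrier T" if "a \<in> carrier H" "b \<in> carrier H" for a b
    using \<psi>_wedge[OF that] that by (intro image_eqI[of _ _ "\<pi> a \<and>\<^sub>G \<pi> b"]) auto
  then have "derived H (carrier H) \<subseteq> \<psi> ` carrier T"
    by (rule H.derived_subset_if_commutators[OF \<psi>.img_is_subgroup])
  then have "kernel H G \<pi> \<subseteq> \<psi> ` kernel T G d"
    using der by (auto simp: kernel_def \<pi>\<psi>)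
  with \<psi> \<psi>_wedge that show ?thesis by blast
qed

end


section \<open>Schur covers and the deep commuting graph\<close>

context group_wedge
begin

lemma finite_schur_multiplier:
  assumes "finite (carrier G)"
  shows "finite (carrier (schur_multiplier G))"
  using finite_exterior_square[OF assms]
  by (rule finite_subset[rotated]) (auto simp: schur_multiplier_def kernel_def)

lemma central_extension_order:
  assumes H: "central_extension G H \<pi>"
  shows "order H = card (kernel H G \<pi>) * order G"
proof -
  interpret \<pi>: group_hom H G \<pi>
    using H by (simp add: central_extension_def group_hom_def group_hom_axioms_def group_axioms)
  have fin: "finite (carrier H)" and onto: "\<pi> ` carrier H = carrier G"
    using H by (auto simp: central_extension_def)
  show ?thesis
    using \<pi>.order_eq_kernel_image[OF fin] by (simp only: onto order_def[of G])
qed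

lemma stem_extension_order_le:
  assumes fin: "finite (carrier G)" and H: "stem_extension G H \<pi>"
  shows "order H \<le> order (schur_multiplier G) * order G"
proof -
  obtain \<psi> where "kernel H G \<pi> \<subseteq> \<psi> ` kernel T G d"
    by (rule stem_extension_wedge_hom[OF H]) (erule that)
  then have "card (kernel H G \<pi>) \<le> order (schur_multiplier G)"
    using finite_schur_multiplier[OF fin] surj_card_le by (simp add: schur_multiplier_def order_def)
  moreover have "order H = card (kernel H G \<pi>) * order G"
    using H by (intro central_extension_order) (simp add: stem_extension_def)
  ultimately show ?thesis
    by simp
qed

lemma stem_extension_full_order_exists:
  assumes fin: "finite (carrier G)"
  obtains W :: "nat monoid" and p where "stem_extension G W p"
    "order W = order (schur_multiplier G) * order G"
proof -
  obtain W :: "nat monoid" and \<iota> p where W: "wedge_extension G W \<iota> p" "finite (carrier W)"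
    "p ` carrier W = carrier G"
    using wedge_extension_onto_exists[OF fin] by blast
  interpret W: wedge_extension G W \<iota> p by (rule W(1))
  have "stem_extension G W p"
    by (rule W.wedge_extension_onto_imp_stem[OF W(2,3)])
  then show ?thesis
    using that[of W p] central_extension_order[of W p]
    by (simp add: stem_extension_def W.card_kernel_p)
qed

lemma schur_cover_exists:
  assumes fin: "finite (carrier G)"
  shows "\<exists>(W :: nat monoid) p. schur_cover G W p"
proof -
  obtain W :: "nat monoid" and p where W: "stem_extension G W p"
      "order W = order (schur_multiplier G) * order G"
    using stem_extension_full_order_exists[OF fin] by blast
  then have "schur_cover G W p"
    using stem_extension_order_le[OF fin] by (auto simp: schur_cover_def)
  then show ?thesis by blast
qed

text \<open>The commutator of the lifts is the image of the wedge under the homomorphism of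
  \<open>stem_extension_wedge_hom\<close>. A Schur cover attains the bound of \<open>stem_extension_order_le\<close>, so this
  homomorphism maps the Schur multiplier onto a set of at least the same finite size and is injective
  there.\<close>
lemma schur_cover_lifts_commute_iff:
  assumes fin: "finite (carrier G)" and H: "schur_cover G H \<pi>"
    and a: "a \<in> carrier H" and b: "b \<in> carrier H" and comm: "\<pi> a \<otimes> \<pi> b = \<pi> b \<otimes> \<pi> a"
  shows "a \<otimes>\<^bsub>H\<^esub> b = b \<otimes>\<^bsub>H\<^esub> a \<longleftrightarrow> \<pi> a \<and>\<^sub>G \<pi> b = \<one>\<^bsub>T\<^esub>"
proof -
  have stem: "stem_extension G H \<pi>" and ce: "central_extension G H \<pi>"
    using H by (auto simp: schur_cover_def stem_extension_def)
  obtain \<psi> where \<psi>: "\<psi> \<in> hom T H"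
    and \<psi>_wedge: "\<And>a b. a \<in> carrier H \<Longrightarrow> b \<in> carrier H \<Longrightarrow> \<psi> (\<pi> a \<and>\<^sub>G \<pi> b) = commutator H a b"
    and ker: "kernel H G \<pi> \<subseteq> \<psi> ` kernel T G d"
    by (rule stem_extension_wedge_hom[OF stem]) (rule that)
  interpret H: group H
    using ce by (simp add: central_extension_def)
  interpret \<pi>: group_hom H G \<pi>
    using ce by (simp add: central_extension_def group_hom_def group_hom_axioms_def group_axioms)
  interpret \<psi>: group_hom T H \<psi>
    using \<psi> by (simp add: group_hom_def group_hom_axioms_def T.group_axioms H.group_axioms)
  have M: "finite (kernel T G d)" "card (kernel T G d) = order (schur_multiplier G)"
    using finite_schur_multiplier[OF fin] by (simp_all add: schur_multiplier_def order_def)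
  obtain W :: "nat monoid" and p where "stem_extension G W p"
      "order W = order (schur_multiplier G) * order G"
    using stem_extension_full_order_exists[OF fin] by blast
  then have "order (schur_multiplier G) * order G \<le> order H"
    using H by (auto simp: schur_cover_def)
  also have "\<dots> = card (kernel H G \<pi>) * order G"
    by (rule central_extension_order[OF ce])
  finally have "order (schur_multiplier G) * order G \<le> card (kernel H G \<pi>) * order G" .
  then have "card (kernel T G d) \<le> card (kernel H G \<pi>)"
    using fin M by (simp add: order_gt_0_iff_finite)
  also have "\<dots> \<le> card (\<psi> ` kernel T G d)"
    using M ker by (intro card_mono) auto
  finally have inj: "inj_on \<psi> (kernel T G d)"
    using M card_image_le[OF M(1), of \<psi>] by (intro eq_card_imp_inj_on) auto
  have w: "\<pi> a \<and>\<^sub>G \<pi> b \<in> kernel T G d" "\<one>\<^bsub>T\<^esub> \<in> kernel T G d"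
    using a b comm by (simp_all add: kernel_def commutator_eq_one_iff)
  have "a \<otimes>\<^bsub>H\<^esub> b = b \<otimes>\<^bsub>H\<^esub> a \<longleftrightarrow> \<psi> (\<pi> a \<and>\<^sub>G \<pi> b) = \<psi> \<one>\<^bsub>T\<^esub>"
    using a b by (simp add: \<psi>_wedge H.commutator_eq_one_iff)
  then show ?thesis
    using inj_on_eq_iff[OF inj w] by simp
qed

lemma deep_commuting_graph_eq_wedge_trivial:
  assumes fin: "finite (carrier G)"
  shows "deep_commuting_graph G =
    {{x, y} | x y. x \<in> carrier G \<and> y \<in> carrier G \<and> x \<noteq> y \<and> x \<otimes> y = y \<otimes> x \<and> x \<and>\<^sub>G y = \<one>\<^bsub>T\<^esub>}"
proof -
  obtain H :: "nat monoid" and \<pi> where H: "schur_cover G H \<pi>"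
    and deep: "deep_commuting_graph G = lifted_commuting_graph G H \<pi>"
  proof -
    have ex: "\<exists>c. (case c of (H :: nat monoid, \<pi>) \<Rightarrow> schur_cover G H \<pi>)"
      using schur_cover_exists[OF fin] by auto
    obtain H :: "nat monoid" and \<pi> where eq: "(SOME (H, \<pi>). schur_cover G (H :: nat monoid) \<pi>) = (H, \<pi>)"
      by (rule prod.exhaust)
    have "schur_cover G H \<pi>"
      using someI_ex[OF ex] unfolding eq by simp
    moreover have "deep_commuting_graph G = lifted_commuting_graph G H \<pi>"
      unfolding deep_commuting_graph_def eq by simp
    ultimately show ?thesis
      by (rule that)
  qed
  have ce: "central_extension G H \<pi>"
    using H by (auto simp: schur_cover_def stem_extension_def)
  interpret \<pi>: group_hom H G \<pi>
    using ce by (simp add: central_extension_def group_hom_def group_hom_axioms_def group_axioms)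
  have "(\<exists>a\<in>carrier H. \<exists>b\<in>carrier H. \<pi> a = x \<and> \<pi> b = y \<and> a \<otimes>\<^bsub>H\<^esub> b = b \<otimes>\<^bsub>H\<^esub> a) \<longleftrightarrow>
      x \<otimes> y = y \<otimes> x \<and> x \<and>\<^sub>G y = \<one>\<^bsub>T\<^esub>" (is "?L \<longleftrightarrow> ?R") if xy: "x \<in> carrier G" "y \<in> carrier G" for x y
  proof
    assume ?L
    then obtain a b where ab: "a \<in> carrier H" "b \<in> carrier H" "\<pi> a = x" "\<pi> b = y"
        "a \<otimes>\<^bsub>H\<^esub> b = b \<otimes>\<^bsub>H\<^esub> a"
      by blast
    then have "\<pi> a \<otimes> \<pi> b = \<pi> b \<otimes> \<pi> a"
      by (metis \<pi>.hom_mult)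
    then show ?R
      using schur_cover_lifts_commute_iff[OF fin H ab(1,2)] ab by simp
  next
    assume R: ?R
    obtain a b where ab: "a \<in> carrier H" "b \<in> carrier H" "\<pi> a = x" "\<pi> b = y"
      using xy ce unfolding central_extension_def by (metis imageE)
    then show ?L
      using schur_cover_lifts_commute_iff[OF fin H ab(1,2)] R by auto
  qed
  then show ?thesis
    unfolding deep lifted_commuting_graph_def by (intro Collect_cong ex_cong1 conj_cong refl)
qed

text \<open>The graphs have no loops, but the wedge of an element with itself is trivial anyway; and an edge
  determines its ends only up to order, which is harmless since swapping the factors inverts a
  wedge.\<close>
lemma deep_eq_commuting_iff:
  assumes fin: "finite (carrier G)"
  shows "deep_commuting_graph G = commuting_graph G \<longleftrightarrow>
    (\<forall>x\<in>carrier G. \<forall>y\<in>carrier G. x \<otimes> y = y \<otimes> x \<longrightarrow> x \<and>\<^sub>G y = \<one>\<^bsub>T\<^esub>)" (is "?L \<longleftrightarrow> ?R")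
proof
  assume L: ?L
  show ?R
  proof (intro ballI impI)
    fix x y assume xy: "x \<in> carrier G" "y \<in> carrier G" "x \<otimes> y = y \<otimes> x"
    show "x \<and>\<^sub>G y = \<one>\<^bsub>T\<^esub>"
    proof (cases "x = y")
      case False
      with xy have "{x, y} \<in> deep_commuting_graph G"
        unfolding L commuting_graph_def by (intro CollectI exI[of _ x] exI[of _ y]) simp
      then obtain x' y' where "{x, y} = {x', y'}" "x' \<in> carrier G" "y' \<in> carrier G" "x' \<and>\<^sub>G y' = \<one>\<^bsub>T\<^esub>"
        unfolding deep_commuting_graph_eq_wedge_trivial[OF fin] by (elim CollectE exE conjE) (rule that)
      then show ?thesis
        using inv_wedge[of x' y'] by (auto simp: doubleton_eq_iff)
    qed (use xy in simp)
  qed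
next
  assume R: ?R
  show ?L
    unfolding deep_commuting_graph_eq_wedge_trivial[OF fin] commuting_graph_def
    by (intro Collect_cong ex_cong1) (use R in blast)
qed

end


section \<open>The Bogomolov multiplier\<close>

context group_wedge
begin

lemma subgroup_M0: "subgroup (M0 G) (schur_multiplier G)"
proof -
  have "{wedge G x y | x y. x \<in> carrier G \<and> y \<in> carrier G \<and> cm x y = \<one>} \<subseteq> carrier T"
    by auto
  then have "subgroup (M0 G) T"
    unfolding M0_def by (rule T.generate_is_subgroup)
  moreover have "subgroup (kernel T G d) T"
    by (rule d.subgroup_kernel)
  ultimately show ?thesis
    using M0_subset_schur_multiplier T.subgroup_incl by (simp add: schur_multiplier_def)
qed

lemma M0_trivial_iff:
  "M0 G = {\<one>\<^bsub>T\<^esub>} \<longleftrightarrow>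
    (\<forall>x\<in>carrier G. \<forall>y\<in>carrier G. x \<otimes> y = y \<otimes> x \<longrightarrow> x \<and>\<^sub>G y = \<one>\<^bsub>T\<^esub>)" (is "?L \<longleftrightarrow> ?R")
proof
  assume L: ?L
  show ?R
  proof (intro ballI impI)
    fix x y assume xy: "x \<in> carrier G" "y \<in> carrier G" "x \<otimes> y = y \<otimes> x"
    then have "x \<and>\<^sub>G y \<in> M0 G"
      unfolding M0_def
      by (intro generate.incl CollectI exI[of _ x] exI[of _ y]) (simp add: commutator_eq_one_iff)
    with L show "x \<and>\<^sub>G y = \<one>\<^bsub>T\<^esub>" by simp
  qed
next
  assume R: ?R
  have "M0 G \<subseteq> {\<one>\<^bsub>T\<^esub>}"
    unfolding M0_def
    by (rule T.generate_subgroup_incl[OF _ T.triv_subgroup]) (use R in \<open>auto simp: commutator_eq_one_iff\<close>)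
  then show ?L
    using subgroup.one_closed[OF subgroup_M0] by (auto simp: schur_multiplier_def)
qed

lemma bogomolov_order_eq_iff:
  assumes fin: "finite (carrier G)"
  shows "order (bogomolov_multiplier G) = order (schur_multiplier G) \<longleftrightarrow> M0 G = {\<one>\<^bsub>T\<^esub>}"
proof -
  interpret S: group "schur_multiplier G"
    by (rule group_schur_multiplier)
  have "order (bogomolov_multiplier G) * card (M0 G) = order (schur_multiplier G)"
    using S.lagrange[OF subgroup_M0] by (simp add: bogomolov_multiplier_def FactGroup_def order_def)
  moreover have "0 < order (schur_multiplier G)"
    using finite_schur_multiplier[OF fin] S.order_gt_0_iff_finite by simp
  moreover have "card (M0 G) = 1 \<longleftrightarrow> M0 G = {\<one>\<^bsub>T\<^esub>}"
    using subgroup.one_closed[OF subgroup_M0] by (auto simp: card_1_singleton_iff schur_multiplier_def)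
  ultimately show ?thesis
    by (metis mult_cancel1 mult.right_neutral less_not_refl mult_0)
qed

lemma bogomolov_iso_iff:
  assumes fin: "finite (carrier G)"
  shows "bogomolov_multiplier G \<cong> schur_multiplier G \<longleftrightarrow> M0 G = {\<one>\<^bsub>T\<^esub>}"
proof
  assume "bogomolov_multiplier G \<cong> schur_multiplier G"
  then have "order (bogomolov_multiplier G) = order (schur_multiplier G)"
    unfolding order_def by (rule iso_same_card)
  then show "M0 G = {\<one>\<^bsub>T\<^esub>}"
    by (simp only: bogomolov_order_eq_iff[OF fin])
next
  interpret S: group "schur_multiplier G"
    by (rule group_schur_multiplier)
  assume "M0 G = {\<one>\<^bsub>T\<^esub>}"
  then show "bogomolov_multiplier G \<cong> schur_multiplier G"
    using S.trivial_factor_iso by (auto simp: bogomolov_multiplier_def is_iso_def schur_multiplier_def)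
qed

end

theorem theorem5p1:
  fixes G :: "('a, 'm) monoid_scheme"
  assumes "group G" and "finite (carrier G)"
  shows "(deep_commuting_graph G = commuting_graph G \<longleftrightarrow>
            bogomolov_multiplier G \<cong> schur_multiplier G) \<and>
         (deep_commuting_graph G = commuting_graph G \<longleftrightarrow>
            order (bogomolov_multiplier G) = order (schur_multiplier G))"
proof -
  interpret group_wedge G
    using assms(1) by (rule group_wedge.intro)
  show ?thesis
    using assms(2) by (simp add: deep_eq_commuting_iff bogomolov_iso_iff
         bogomolov_order_eq_iff M0_trivial_iff)
qed

end
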